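(* Let $c_0\in\mathbb{M}$ be a Misiurewicz parameter of the quadratic family $f_c(z)=z^2+c$. Then there exist a non-constant entire function $\phi:\mathbb{C}\to\mathbb{C}$, a sequence $(\rho_k)_{k\in\mathbb{N}}$ of nonzero complex numbers with $\rho_k\to 0$, and a constant $q\in\mathbb{C}$, $q\neq 0$, such that, setting $\mathcal{J}:=\phi^{-1}(J_{c_0})\subset\mathbb{C}$, for every sufficiently large constant $r>0$ we have (a) $[\rho_k^{-1}(J_{c_0}-c_0)]_r\to[\mathcal{J}]_r$, and (b) $[\rho_k^{-1}q(\mathbb{M}-c_0)]_r\to[\mathcal{J}]_r$ as $k\to\infty$ in the Hausdorff topology.
   Context: For $c\in\mathbb{C}$ let $f_c(z)=z^2+c$, and let $f_c^n$ denote the $n$-th iterate. The Mandelbrot set $\mathbb{M}$ is the set of $c\in\mathbb{C}$ such that the sequence $(f_c^n(c))_{n\in\mathbb{N}}$ is bounded. The filled Julia set $K_c$ is the set of $z\in\mathbb{C}$ such that $(f_c^n(z))_{n\in\mathbb{N}}$ is bounded, and the Julia set is $J_c=\partial K_c$. All of $\mathbb{M},K_c,J_c$ are non-empty compact sets. A parameter $c_0\in\mathbb{M}$ is a Misiurewicz parameter if the forward orbit of $c_0$ under $f_{c_0}$ eventually lands on a repelling periodic point; that is, there exist (minimal) $l\ge1$ and $p\ge1$ such that $a_0:=f_{c_0}^l(c_0)$ satisfies $a_0=f_{c_0}^p(a_0)$ and $|(f_{c_0}^p)'(a_0)|>1$. Notation: $\mathbb{D}(r)=\{z\in\mathbb{C}: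 |z|<r\}$. For a closed set $K\subset\mathbb{C}$, $[K]_r:=(K\cap\mathbb{D}(r))\cup\partial\mathbb{D}(r)$. For $a\in\mathbb{C}\setminus\{0\}$ and $b\in\mathbb{C}$, $a(K-b):=\{a(z-b): z\in K\}$. Hausdorff topology: a sequence of non-empty compact sets $K_k\subset\mathbb{C}$ converges to a non-empty compact set $K\subset\mathbb{C}$ if for every $\epsilon>0$ there is $k_0$ such that $K\subset N_\epsilon(K_k)$ and $K_k\subset N_\epsilon(K)$ for all $k\ge k_0$, where $N_\epsilon(\cdot)$ is the open $\epsilon$-neighborhood in $\mathbb{C}$. *)

theory Defs
  imports "HOL-Analysis.Analysis"
begin

section \<open>The quadratic family\<close>

definition quad :: "complex \<Rightarrow> complex \<Rightarrow> complex" where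
  "quad c z = z\<^sup>2 + c"

definition mandelbrot :: "complex set" where
  "mandelbrot = {c. bounded (range (\<lambda>n. (quad c ^^ n) c))}"

definition filled_julia :: "complex \<Rightarrow> complex set" where
  "filled_julia c = {z. bounded (range (\<lambda>n. (quad c ^^ n) z))}"

definition julia :: "complex \<Rightarrow> complex set" where
  "julia c = frontier (filled_julia c)"

text \<open>
  The exponents \<open>l\<close> and \<open>p\<close> are not required to be minimal. Whenever some pair of exponents
  satisfies the condition, so does the pair of minimal ones: the multiplier along a
  multiple of the exact period is a power of the multiplier along the exact period, and
  all points of a cycle have the same multiplier. (The minimal \<open>l\<close> is never \<open>0\<close>: if the
  critical value \<open>c\<close> itself is periodic, then its cycle contains the critical point
  and is not repelling.)
\<close>

definition misiurewicz :: "complex \<Rightarrow> bool" where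
  "misiurewicz c \<longleftrightarrow> c \<in> mandelbrot \<and>
     (\<exists>l\<ge>1. \<exists>p\<ge>1. let a = (quad c ^^ l) c in
        (quad c ^^ p) a = a \<and> norm (deriv (quad c ^^ p) a) > 1)"


section \<open>Hausdorff convergence of truncated rescaled sets\<close>

text \<open>The set \<open>a(K - b)\<close>.\<close>

definition rescale :: "complex \<Rightarrow> complex \<Rightarrow> complex set \<Rightarrow> complex set" where
  "rescale a b K = (\<lambda>z. a * (z - b)) ` K"

text \<open>The set \<open>[K]\<^sub>r\<close>. It is compact for closed \<open>K\<close>, as the boundary circle is added.\<close>

definition truncate_disk :: "real \<Rightarrow> complex set \<Rightarrow> complex set" where
  "truncate_disk r K = (K \<inter> ball 0 r) \<union> frontier (ball 0 r)"

definition nbhd :: "real \<Rightarrow> complex set \<Rightarrow> complex set" where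
  "nbhd \<epsilon> K = (\<Union>x\<in>K. ball x \<epsilon>)"

text \<open>
  Hausdorff convergence is a notion for non-empty compact sets only, so
  non-emptiness and compactness of all the sets involved are part of the definition.
\<close>

definition hausdorff_converges :: "(nat \<Rightarrow> complex set) \<Rightarrow> complex set \<Rightarrow> bool" where
  "hausdorff_converges L K \<longleftrightarrow>
     (\<forall>k. compact (L k) \<and> L k \<noteq> {}) \<and> compact K \<and> K \<noteq> {} \<and>
     (\<forall>\<epsilon>>0. \<exists>k0. \<forall>k\<ge>k0. K \<subseteq> nbhd \<epsilon> (L k) \<and> L k \<subseteq> nbhd \<epsilon> K)"

end

theory Submission
  imports Defs "HOL-Complex_Analysis.Complex_Analysis"
begin

text \<open>
  Let \<open>c\<close> be the Misiurewicz parameter, \<open>a\<close> the point of the repelling cycle that the critical value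
  reaches after \<open>m\<close> steps, \<open>p\<close> a period of \<open>a\<close> and \<open>l\<close> the multiplier. The Poincare function \<open>\<phi>\<close> is the
  entire function with \<open>\<phi> 0 = a\<close> and derivative \<open>1\<close> at \<open>0\<close> that satisfies
  \<open>\<phi> (l * w) = (quad c ^^ p) (\<phi> w)\<close> (lemma \<open>poincare_function\<close>).

  In the dynamical plane, a disk of radius about \<open>1 / l ^ k\<close> around \<open>c\<close> is mapped by \<open>m\<close> steps almost
  linearly to a neighbourhood of \<open>a\<close>, and \<open>p * k\<close> further steps blow it up to the scale of \<open>\<phi>\<close>: with
  \<open>\<rho> k = 1 / (A * l ^ k)\<close>, where \<open>A\<close> is the derivative of the first \<open>m\<close> steps, the maps
  \<open>w \<mapsto> (quad c ^^ (m + p * k)) (c + \<rho> k * w)\<close> converge to \<open>\<phi>\<close>. In the parameter plane the same holds for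
  the orbit of the critical value \<open>c'\<close> under \<open>quad c'\<close>, where \<open>c' = c + \<rho> k * w / q\<close>: the repelling point
  moves with \<open>c'\<close> too, and the factor \<open>q\<close> accounts for the speed of the \<open>m\<close>-th iterate relative to it.
  Lemma \<open>shadowing\<close> proves both limits. The magnified sets consist of the points \<open>w\<close> that these maps send
  to points with bounded orbits, and lemma \<open>escape_sets_converge\<close> shows that such sets converge when
  the maps do.

  Two facts about Misiurewicz parameters enter. First, \<open>q\<close> has to be nonzero, that is, the critical
  value must not follow the repelling point to first order (lemma \<open>transversality\<close>). The proof is
  arithmetic: \<open>c\<close> is an algebraic integer, and up to nonzero factors the derivative in question is \<open>2\<close>
  times a number that is congruent to \<open>1\<close> modulo each prime above \<open>2\<close>. Second, the filled Julia set has no interior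
  (theorem \<open>filled_julia_interior_empty\<close>), so that it equals the Julia set; this holds as inverse
  branches of high iterates contract away from the finite postcritical set.
\<close>

section \<open>Escape to infinity\<close>

lemma quad_iter_Suc: "(quad c ^^ Suc n) z = ((quad c ^^ n) z)\<^sup>2 + c"
  by (simp add: quad_def)

lemma quad_iter_add: "(quad c ^^ (m + n)) z = (quad c ^^ m) ((quad c ^^ n) z)"
  by (simp add: funpow_add)

lemma holomorphic_on_quad_iter [holomorphic_intros]:
  assumes "C holomorphic_on S" "V holomorphic_on S"
  shows "(\<lambda>w. (quad (C w) ^^ n) (V w)) holomorphic_on S"
  using assms by (induction n) (auto simp: quad_def intro!: holomorphic_intros)

lemma continuous_on_quad_iter [continuous_intros]:
  assumes "continuous_on S C" "continuous_on S V"
  shows "continuous_on S (\<lambda>w. (quad (C w) ^^ n) (V w))"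
  using assms by (induction n) (auto simp: quad_def intro!: continuous_intros)

lemma tendsto_quad_iter [tendsto_intros]:
  assumes "(C \<longlongrightarrow> c) F" "(V \<longlongrightarrow> v) F"
  shows "((\<lambda>w. (quad (C w) ^^ n) (V w)) \<longlongrightarrow> (quad c ^^ n) v) F"
  using assms by (induction n) (auto simp: quad_def intro!: tendsto_intros)

text \<open>
  Beyond the radius \<open>norm c + 2\<close> the square dominates, which turns boundedness of an orbit into
  the closed condition that it never leaves that disk.
\<close>

lemma quad_doubles_norm:
  assumes "norm z \<ge> norm c + 2"
  shows "norm (quad c z) \<ge> 2 * norm z"
proof -
  have "norm c * 1 \<le> norm c * norm z"
    using assms norm_ge_zero[of c] by (intro mult_left_mono) linarith+
  then have "2 * norm z \<le> norm z * (norm c + 2) - norm c"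
    by (simp add: algebra_simps)
  also have "\<dots> \<le> norm z * norm z - norm c"
    using assms by (intro diff_right_mono mult_left_mono) auto
  also have "\<dots> \<le> norm (quad c z)"
    using norm_triangle_ineq2[of "z\<^sup>2" "- c"] by (simp add: quad_def norm_power power2_eq_square norm_mult)
  finally show ?thesis .
qed

lemma quad_iter_doubles_norm:
  assumes "norm z \<ge> norm c + 2"
  shows "norm ((quad c ^^ n) z) \<ge> 2 ^ n * norm z"
proof (induction n)
  case (Suc n)
  have "norm z \<le> 2 ^ n * norm z"
    by (simp add: mult_le_cancel_right1)
  then have "norm ((quad c ^^ n) z) \<ge> norm c + 2"
    using Suc assms by linarith
  then have "norm (quad c ((quad c ^^ n) z)) \<ge> 2 * norm ((quad c ^^ n) z)"
    by (rule quad_doubles_norm)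
  then show ?case using Suc by simp
qed simp

lemma quad_iter_norm_ge:
  assumes "norm z \<ge> norm c + 2"
  shows "norm ((quad c ^^ n) z) \<ge> norm z"
proof -
  have "norm z \<le> 2 ^ n * norm z"
    by (simp add: mult_le_cancel_right1)
  then show ?thesis using quad_iter_doubles_norm[OF assms, of n] by linarith
qed

lemma quad_orbit_escapes:
  assumes "norm ((quad c ^^ m) z) > norm c + 2"
  shows "\<exists>N. \<forall>n\<ge>N. norm ((quad c ^^ n) z) \<ge> B"
proof -
  let ?x = "(quad c ^^ m) z"
  obtain j where j: "2 ^ j > B"
    using real_arch_pow[of 2 B] by auto
  have "norm ((quad c ^^ n) z) \<ge> B" if "n \<ge> j + m" for n
  proof -
    have "B \<le> 2 ^ j * 1" using j by simp
    also have "\<dots> \<le> 2 ^ (n - m) * norm ?x"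
    proof (rule mult_mono)
      show "2 ^ j \<le> (2::real) ^ (n - m)" using that by (intro power_increasing) auto
      show "1 \<le> norm ?x" using assms norm_ge_zero[of c] by linarith
    qed auto
    also have "\<dots> \<le> norm ((quad c ^^ (n - m)) ?x)"
      using assms by (intro quad_iter_doubles_norm) simp
    also have "(quad c ^^ (n - m)) ?x = (quad c ^^ n) z"
      using that quad_iter_add[of "n - m" m c z] by simp
    finally show ?thesis .
  qed
  then show ?thesis by blast
qed

lemma filled_julia_iff:
  "z \<in> filled_julia c \<longleftrightarrow> (\<forall>n. norm ((quad c ^^ n) z) \<le> norm c + 2)"
proof
  assume "z \<in> filled_julia c"
  then obtain b where b: "\<And>n. norm ((quad c ^^ n) z) \<le> b"
    by (auto simp: filled_julia_def bounded_iff)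
  show "\<forall>n. norm ((quad c ^^ n) z) \<le> norm c + 2"
  proof (rule ccontr)
    assume "\<not> (\<forall>n. norm ((quad c ^^ n) z) \<le> norm c + 2)"
    then obtain m where "norm ((quad c ^^ m) z) > norm c + 2" by (auto simp: not_le)
    from quad_orbit_escapes[OF this, of "b + 1"] b show False
      by (metis add_le_same_cancel1 dual_order.trans not_one_le_zero order_refl)
  qed
qed (auto simp: filled_julia_def bounded_iff)

lemma escapes_if_not_filled_julia:
  assumes "z \<notin> filled_julia c"
  shows "\<exists>N. \<forall>n\<ge>N. norm ((quad c ^^ n) z) \<ge> B"
proof -
  obtain m where "norm ((quad c ^^ m) z) > norm c + 2"
    using assms unfolding filled_julia_iff by (auto simp: not_le)
  then show ?thesis by (rule quad_orbit_escapes)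
qed

lemma mandelbrot_iff: "c \<in> mandelbrot \<longleftrightarrow> c \<in> filled_julia c"
  by (simp add: mandelbrot_def filled_julia_def)

lemma closed_filled_julia: "closed (filled_julia c)"
proof -
  have "filled_julia c = (\<Inter>n. {z. norm ((quad c ^^ n) z) \<le> norm c + 2})"
    by (auto simp: filled_julia_iff)
  moreover have "closed (\<Inter>n. {z. norm ((quad c ^^ n) z) \<le> norm c + 2})"
    by (intro closed_INT ballI closed_Collect_le continuous_intros)
  ultimately show ?thesis by simp
qed

lemma quad_iter_in_filled_julia_iff:
  "(quad c ^^ n) z \<in> filled_julia c \<longleftrightarrow> z \<in> filled_julia c"
proof
  assume "z \<in> filled_julia c"
  then show "(quad c ^^ n) z \<in> filled_julia c"
    unfolding filled_julia_iff by (metis quad_iter_add)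
next
  assume *: "(quad c ^^ n) z \<in> filled_julia c"
  show "z \<in> filled_julia c"
  proof (rule ccontr)
    assume "z \<notin> filled_julia c"
    then obtain N where N: "\<forall>m\<ge>N. norm ((quad c ^^ m) z) \<ge> norm c + 3"
      using escapes_if_not_filled_julia by blast
    moreover have "norm ((quad c ^^ (N + n)) z) \<le> norm c + 2"
      using * unfolding filled_julia_iff by (metis quad_iter_add)
    moreover have "norm ((quad c ^^ (N + n)) z) \<ge> norm c + 3" using N by simp
    ultimately show False by linarith
  qed
qed

section \<open>Transversality by reduction modulo two\<close>

text \<open>
  A linear system whose diagonal is odd and whose other coefficients are even has odd determinant,
  hence only the trivial complex solution. Gaussian elimination shows this without determinants:
  eliminating one unknown preserves the parity pattern.
\<close>

lemma even_system_imp_zero: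
  fixes x :: "nat \<Rightarrow> complex" and d :: "nat \<Rightarrow> int" and A :: "nat \<Rightarrow> nat \<Rightarrow> int"
  assumes "\<And>i. i < n \<Longrightarrow> odd (d i)"
    and "\<And>i. i < n \<Longrightarrow> of_int (d i) * x i = 2 * (\<Sum>j<n. of_int (A i j) * x j)"
    and "i < n"
  shows "x i = 0"
  using assms
proof (induction n arbitrary: d A i)
  case (Suc n)
  define e where "e = d n - 2 * A n n"
  have e: "odd e" using Suc.prems(1)[of n] by (simp add: e_def)
  have en: "of_int e * x n = 2 * (\<Sum>j<n. of_int (A n j) * x j)"
    using Suc.prems(2)[of n] by (simp add: e_def algebra_simps)
  have lower: "x i = 0" if "i < n" for i
  proof (rule Suc.IH[of "\<lambda>i. e * d i" "\<lambda>i j. e * A i j + 2 * A i n * A n j" i])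
    fix i assume i: "i < n"
    show "odd (e * d i)" using e Suc.prems(1)[of i] i by simp
    have "of_int (e * d i) * x i = of_int e * (of_int (d i) * x i)" by simp
    also have "\<dots> = of_int e * (2 * (\<Sum>j<Suc n. of_int (A i j) * x j))"
      using Suc.prems(2)[of i] i by simp
    also have "\<dots> = 2 * (\<Sum>j<n. of_int (e * A i j) * x j) + 2 * of_int (A i n) * (of_int e * x n)"
      by (simp add: sum_distrib_left algebra_simps)
    also have "\<dots> = 2 * (\<Sum>j<n. of_int (e * A i j + 2 * A i n * A n j) * x j)"
      unfolding en by (simp add: sum_distrib_left sum.distrib algebra_simps)
    finally show "of_int (e * d i) * x i = \<dots>" .
  qed (use that in auto)
  moreover have "x n = 0"
  proof -
    have "of_int e * x n = 0" using en lower by simp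
    moreover have "e \<noteq> 0" using e by auto
    ultimately show ?thesis by simp
  qed
  ultimately show ?case using Suc.prems(3) by (metis less_Suc_eq)
qed simp

abbreviation eval_int :: "int poly \<Rightarrow> complex \<Rightarrow> complex" where
  "eval_int g x \<equiv> poly (map_poly of_int g) x"

lemma eval_int_hom:
  "eval_int (g + h) x = eval_int g x + eval_int h x"
  "eval_int (g - h) x = eval_int g x - eval_int h x"
  "eval_int (g * h) x = eval_int g x * eval_int h x"
  "eval_int (g ^ n) x = eval_int g x ^ n"
  "eval_int [:a:] x = of_int a"
  "eval_int [:0, 1:] x = x"
  "eval_int (numeral m) x = numeral m"
  "eval_int 1 x = 1"
proof -
  show add: "eval_int (g + h) x = eval_int g x + eval_int h x" for g h
    by (induction g h rule: poly_induct2) (simp_all add: map_poly_pCons algebra_simps)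
  have smult: "eval_int (smult a g) x = of_int a * eval_int g x" for a g
    by (induction g) (simp_all add: map_poly_pCons algebra_simps)
  show "eval_int (g - h) x = eval_int g x - eval_int h x"
    using add[of "g - h" h] by simp
  show mult: "eval_int (g * h) x = eval_int g x * eval_int h x" for g h
    by (induction g) (simp_all add: map_poly_pCons add smult algebra_simps)
  show one: "eval_int 1 x = 1"
    by (simp add: one_pCons map_poly_pCons)
  show "eval_int (g ^ n) x = eval_int g x ^ n"
    by (induction n) (simp_all add: one mult)
  show "eval_int [:a:] x = of_int a" "eval_int [:0, 1:] x = x"
    by (simp_all add: map_poly_pCons)
  show "eval_int (numeral m) x = numeral m"
    by (simp add: numeral_poly map_poly_pCons)
qed

text \<open>
  A monic equation for \<open>x\<close> makes the ring generated by \<open>x\<close> a finitely generated abelian group.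
\<close>

lemma eval_int_spanned:
  assumes m: "lead_coeff m = 1" and root: "eval_int m x = 0"
  shows "\<exists>a :: nat \<Rightarrow> int. eval_int g x = (\<Sum>i<degree m. of_int (a i) * x ^ i)"
proof (induction g)
  case 0
  show ?case by (intro exI[of _ "\<lambda>_. 0"]) simp
next
  case (pCons b g)
  let ?n = "degree m"
  obtain a where a: "eval_int g x = (\<Sum>i<?n. of_int (a i) * x ^ i)" using pCons by blast
  have "eval_int m x = (\<Sum>i\<le>?n. of_int (coeff m i) * x ^ i)"
    by (simp add: poly_altdef degree_map_poly coeff_map_poly)
  also have "\<dots> = (\<Sum>i<?n. of_int (coeff m i) * x ^ i) + x ^ ?n"
    using m by (simp add: lessThan_Suc_atMost[symmetric])
  finally have top: "x ^ ?n = - (\<Sum>i<?n. of_int (coeff m i) * x ^ i)"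
    using root by (simp add: add_eq_0_iff)
  have n0: "?n \<noteq> 0"
  proof
    assume "?n = 0"
    then have "x ^ ?n = 1" "(\<Sum>i<?n. of_int (coeff m i) * x ^ i) = 0" by simp_all
    then show False using top by simp
  qed
  then obtain n where n: "?n = Suc n" by (cases ?n) auto
  define a' where "a' i = (if i = 0 then b else a (i - 1)) - a n * coeff m i" for i
  have "eval_int (pCons b g) x = of_int b + (\<Sum>i<Suc n. of_int (a i) * x ^ Suc i)"
    by (simp add: map_poly_pCons a n sum_distrib_left algebra_simps)
  also have "\<dots> = of_int b + (\<Sum>i<n. of_int (a i) * x ^ Suc i) + of_int (a n) * x ^ ?n"
    by (simp add: n)
  also have "of_int b + (\<Sum>i<n. of_int (a i) * x ^ Suc i)
      = (\<Sum>i<Suc n. of_int (if i = 0 then b else a (i - 1)) * x ^ i)"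
    by (subst sum.lessThan_Suc_shift) simp
  also have "\<dots> + of_int (a n) * x ^ ?n
      = (\<Sum>i<Suc n. of_int (if i = 0 then b else a (i - 1)) * x ^ i)
        - of_int (a n) * (\<Sum>i<Suc n. of_int (coeff m i) * x ^ i)"
    unfolding top by (simp only: n mult_minus_right add_uminus_conv_diff)
  also have "\<dots> = (\<Sum>i<Suc n. of_int (a' i) * x ^ i)"
    unfolding a'_def sum_distrib_left sum_subtractf[symmetric]
    by (intro sum.cong refl) (simp add: algebra_simps)
  finally show ?case using n by metis
qed

text \<open>
  The number \<open>1 / 2\<close> is not an algebraic integer: if it lay in the ring generated by \<open>x\<close>, each power
  of \<open>x\<close> would be twice an integral combination of the finitely many powers that span the ring,
  and these would solve a system with odd diagonal and even remaining coefficients.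
\<close>

lemma half_not_in_monic_ring:
  assumes m: "lead_coeff m = 1" and root: "eval_int m x = 0"
  shows "2 * eval_int g x \<noteq> 1"
proof
  assume half: "2 * eval_int g x = 1"
  let ?n = "degree m"
  have "\<forall>i. \<exists>a. eval_int (g * [:0, 1:] ^ i) x = (\<Sum>j<?n. of_int (a j) * x ^ j)"
    using eval_int_spanned[OF m root] by blast
  then obtain A where A: "\<And>i. eval_int (g * [:0, 1:] ^ i) x = (\<Sum>j<?n. of_int (A i j) * x ^ j)"
    by metis
  have halves: "of_int 1 * x ^ i = 2 * (\<Sum>j<?n. of_int (A i j) * x ^ j)" for i
    unfolding A[symmetric] eval_int_hom using half by (simp add: mult.assoc[symmetric])
  have all_zero: "x ^ i = 0" if "i < ?n" for i
    by (rule even_system_imp_zero[OF _ halves that]) simp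
  have "?n \<noteq> 0"
  proof
    assume "?n = 0"
    then obtain b where "m = [:b:]" by (rule degree_eq_zeroE)
    then show False using m root by (simp add: eval_int_hom)
  qed
  then show False using all_zero[of 0] by simp
qed

text \<open>
  The orbit of the critical point \<open>0\<close>, as polynomials in the parameter.
\<close>

primrec crit_poly :: "nat \<Rightarrow> int poly" where
  "crit_poly 0 = 0"
| "crit_poly (Suc n) = (crit_poly n)\<^sup>2 + [:0, 1:]"

lemma eval_crit_poly: "eval_int (crit_poly n) c = (quad c ^^ n) 0"
  by (induction n) (simp_all add: eval_int_hom quad_def)

lemma crit_poly_monic:
  "degree (crit_poly (Suc n)) = 2 ^ n \<and> lead_coeff (crit_poly (Suc n)) = 1"
proof (induction n)
  case (Suc n)
  let ?P = "crit_poly (Suc n)"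
  have nz: "?P \<noteq> 0" using Suc by auto
  have dsq: "degree (?P\<^sup>2) = 2 ^ Suc n"
    using Suc by (simp add: degree_power_eq nz del: crit_poly.simps)
  have "1 < (2::nat) ^ Suc n"
    by (rule one_less_power) auto
  then have d: "degree [:0, 1::int:] < degree (?P\<^sup>2)"
    unfolding dsq by simp
  have "degree (crit_poly (Suc (Suc n))) = 2 ^ Suc n"
    using degree_add_eq_left[OF d] dsq crit_poly.simps(2)[of "Suc n"] by metis
  moreover have "lead_coeff (crit_poly (Suc (Suc n))) = lead_coeff (?P\<^sup>2)"
    using lead_coeff_add_le[OF d] crit_poly.simps(2)[of "Suc n"] by (metis add.commute)
  moreover have "lead_coeff (?P\<^sup>2) = 1"
    unfolding lead_coeff_power conjunct2[OF Suc] by simp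
  ultimately show ?case using \<open>degree (crit_poly (Suc (Suc n))) = 2 ^ Suc n\<close> by simp
qed simp

lemma crit_poly_diff_monic:
  assumes "p \<ge> 1"
  shows "lead_coeff (crit_poly (n + p) - crit_poly n) = 1"
proof -
  obtain j where j: "n + p = Suc j" using assms by (cases "n + p") auto
  have d: "degree (- crit_poly n) < degree (crit_poly (n + p))"
  proof (cases n)
    case 0
    then show ?thesis using crit_poly_monic[of j] j by simp
  next
    case (Suc i)
    then have "i < j" using j assms by simp
    then show ?thesis using crit_poly_monic[of j] crit_poly_monic[of i] j Suc
      by (simp del: crit_poly.simps)
  qed
  have "lead_coeff (- crit_poly n + crit_poly (n + p)) = lead_coeff (crit_poly (n + p))"
    using d by (rule lead_coeff_add_le)
  moreover have "- crit_poly n + crit_poly (n + p) = crit_poly (n + p) - crit_poly n"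
    by simp
  ultimately show ?thesis using crit_poly_monic[of j] unfolding j by metis
qed

lemma pderiv_crit_poly_Suc:
  "pderiv (crit_poly (Suc n)) = 2 * (crit_poly n * pderiv (crit_poly n)) + 1"
  by (simp add: pderiv_add power2_eq_square pderiv_mult pderiv_pCons one_pCons)

text \<open>
  The derivative of \<open>P\<^sup>2 + c\<close> is congruent to \<open>1\<close> modulo \<open>2\<close>. So modulo \<open>2\<close> all the polynomials of
  the critical orbit have derivative \<open>1\<close>, except for the first one. That one is \<open>0\<close>, so the exception disappears in the product.
\<close>

lemma crit_poly_times_pderiv:
  "\<exists>y. crit_poly n * pderiv (crit_poly n) = crit_poly n + 2 * y"
proof (cases n)
  case (Suc m)
  then show ?thesis
    by (intro exI[of _ "crit_poly n * (crit_poly m * pderiv (crit_poly m))"])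
       (simp only: pderiv_crit_poly_Suc, simp add: algebra_simps)
qed (auto intro: exI[of _ 0])

text \<open>
  Write \<open>u\<close> and \<open>e\<close> for the two points of the critical orbit just before those that add up to \<open>0\<close>.
  Half of the derivative is congruent to \<open>1 + u + e\<close> modulo \<open>2\<close>. As \<open>u\<^sup>2 + e\<^sup>2 = - 2 * c\<close>, the square of
  \<open>u + e\<close> is divisible by \<open>2\<close>. If the derivative vanished, \<open>u + e\<close> would be \<open>- 1\<close> modulo \<open>2\<close>, so \<open>1\<close>
  would be divisible by \<open>2\<close> in a ring of algebraic integers.
\<close>

lemma transversality_first_return:
  assumes "p \<ge> 1" and eq: "(quad c ^^ (n + p)) 0 + (quad c ^^ n) 0 = 0"
    and per: "(quad c ^^ (Suc n + p)) 0 = (quad c ^^ Suc n) 0"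
    and n: "n \<ge> 1"
  shows "eval_int (pderiv (crit_poly (n + p)) + pderiv (crit_poly n)) c \<noteq> 0"
proof
  assume D: "eval_int (pderiv (crit_poly (n + p)) + pderiv (crit_poly n)) c = 0"
  obtain k where k: "n = Suc k" using n by (cases n) auto
  let ?u = "crit_poly (k + p)" and ?e = "crit_poly k"
  obtain y where y: "?u * pderiv ?u = ?u + 2 * y" using crit_poly_times_pderiv by blast
  obtain z where z: "?e * pderiv ?e = ?e + 2 * z" using crit_poly_times_pderiv by blast
  have deriv: "pderiv (crit_poly (n + p)) + pderiv (crit_poly n) = 2 * (1 + (?u + ?e) + 2 * (y + z))"
    unfolding k add_Suc pderiv_crit_poly_Suc y z by (simp add: algebra_simps)
  define t where "t = eval_int (y + z) c"
  define u where "u = eval_int ?u c"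
  define e where "e = eval_int ?e c"
  have "2 * (1 + (u + e) + 2 * t) = 0"
    using D unfolding deriv eval_int_hom u_def e_def t_def by simp
  then have ue: "u + e = - 1 - 2 * t" by algebra
  have "u\<^sup>2 + c + (e\<^sup>2 + c) = 0"
    using eq unfolding k add_Suc quad_iter_Suc u_def e_def eval_crit_poly .
  then have sq: "u\<^sup>2 + e\<^sup>2 = - 2 * c" by algebra
  \<comment> \<open>A witness for \<open>1 / 2\<close>, found by squaring \<open>u + e = - 1 - 2 * t\<close>.\<close>
  let ?g = "?u * ?e - [:0, 1:] - 2 * (y + z) - 2 * (y + z)\<^sup>2"
  have "2 * eval_int ?g c = 2 * (u * e - c - 2 * t - 2 * t\<^sup>2)"
    unfolding t_def u_def e_def eval_int_hom ..
  also have "\<dots> = (u + e)\<^sup>2 - 4 * t - 4 * t\<^sup>2"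
    using sq by algebra
  also have "\<dots> = 1"
    unfolding ue by algebra
  finally have "2 * eval_int ?g c = 1" .
  moreover have "eval_int (crit_poly (Suc n + p) - crit_poly (Suc n)) c = 0"
    unfolding eval_int_hom eval_crit_poly using per by simp
  ultimately show False
    using half_not_in_monic_ring[OF crit_poly_diff_monic[OF assms(1)]] by blast
qed

text \<open>
  The partial derivatives of the iterates in the variable and in the parameter (written out by the
  chain rule).
\<close>

primrec quad_deriv :: "complex \<Rightarrow> nat \<Rightarrow> complex \<Rightarrow> complex" where
  "quad_deriv c 0 z = 1"
| "quad_deriv c (Suc n) z = 2 * (quad c ^^ n) z * quad_deriv c n z"

primrec quad_param_deriv :: "complex \<Rightarrow> nat \<Rightarrow> complex \<Rightarrow> complex" where
  "quad_param_deriv c 0 z = 0"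
| "quad_param_deriv c (Suc n) z = 2 * (quad c ^^ n) z * quad_param_deriv c n z + 1"

lemma has_field_derivative_quad_iter:
  "((quad c ^^ n) has_field_derivative quad_deriv c n z) (at z)"
proof (induction n)
  case (Suc n)
  have "((\<lambda>z. ((quad c ^^ n) z)\<^sup>2 + c) has_field_derivative quad_deriv c (Suc n) z) (at z)"
    by (auto intro!: derivative_eq_intros Suc)
  then show ?case by (simp add: quad_def[abs_def] comp_def)
qed (simp add: id_def)

lemma quad_deriv_eq_0_iff: "quad_deriv c n z = 0 \<longleftrightarrow> (\<exists>i<n. (quad c ^^ i) z = 0)"
  by (induction n) (auto simp: less_Suc_eq)

lemma quad_param_deriv_add:
  "quad_param_deriv c (n + m) z =
    quad_deriv c n ((quad c ^^ m) z) * quad_param_deriv c m z + quad_param_deriv c n ((quad c ^^ m) z)"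
  by (induction n) (simp_all add: funpow_add algebra_simps)

lemma quad_param_deriv_critical: "quad_param_deriv c n 0 = eval_int (pderiv (crit_poly n)) c"
proof (induction n)
  case (Suc n)
  then show ?case
    by (simp only: pderiv_crit_poly_Suc eval_int_hom eval_crit_poly quad_param_deriv.simps) simp
qed simp

text \<open>
  If the critical point returned to itself, it would lie on the cycle that its orbit reaches, and
  the multiplier of that cycle would be \<open>0\<close>.
\<close>

lemma critical_orbit_nonzero:
  assumes per: "(quad c ^^ p) ((quad c ^^ L) 0) = (quad c ^^ L) 0" and "p \<ge> 1"
    and nz: "quad_deriv c p ((quad c ^^ L) 0) \<noteq> 0" and "n \<ge> 1"
  shows "(quad c ^^ n) 0 \<noteq> 0"
proof
  let ?a = "(quad c ^^ L) 0"
  assume zero: "(quad c ^^ n) 0 = 0"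
  have "((quad c ^^ n) ^^ t) 0 = 0" for t
    using zero by (induction t) simp_all
  then have "(quad c ^^ (n * L)) 0 = 0"
    by (simp add: funpow_mult)
  moreover have "n * L = (n * L - L) + L" using \<open>n \<ge> 1\<close> by simp
  ultimately have "(quad c ^^ (n * L - L)) ?a = 0"
    using quad_iter_add by metis
  then have "(quad c ^^ ((n * L - L) mod p)) ?a = 0"
    using funpow_mod_eq[OF per] by metis
  moreover have "(n * L - L) mod p < p" using \<open>p \<ge> 1\<close> by simp
  ultimately show False using nz unfolding quad_deriv_eq_0_iff by blast
qed

text \<open>
  The critical point moves past the preperiodic relation with nonzero speed. This is shown at the
  first time at which the relation holds; later on both sides are multiplied by the derivatives of
  the map along the critical orbit, and those do not vanish.
\<close>

lemma transversality:
  assumes per: "(quad c ^^ p) ((quad c ^^ L) 0) = (quad c ^^ L) 0" and "p \<ge> 1"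
    and nz: "quad_deriv c p ((quad c ^^ L) 0) \<noteq> 0"
  shows "quad_param_deriv c (L + p) 0 \<noteq> quad_param_deriv c L 0"
proof -
  let ?x = "\<lambda>n. (quad c ^^ n) 0"
  note nonzero = critical_orbit_nonzero[OF assms]
  \<comment> \<open>The points that precede the first coincidence are different but have the same square, so they are
    opposite.\<close>
  define N where "N = (LEAST n. ?x (n + p) = ?x n)"
  have ex: "?x (L + p) = ?x L" using per by (simp add: add.commute[of L] quad_iter_add)
  have N: "?x (N + p) = ?x N" and NL: "N \<le> L"
    unfolding N_def by (rule LeastI, rule ex, rule Least_le, rule ex)
  have least: "?x (n + p) \<noteq> ?x n" if "n < N" for n
    using not_less_Least that unfolding N_def by blast
  have "N \<noteq> 0"
    using N nonzero[of p] \<open>p \<ge> 1\<close> by (intro notI) simp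
  then obtain n where n: "N = Suc n" by (cases N) auto
  have "n \<noteq> 0"
  proof
    assume "n = 0"
    then have "?x (Suc p) = c" using N n by (simp add: quad_def)
    then have "?x p = 0" by (simp add: quad_def)
    then show False using nonzero[of p] \<open>p \<ge> 1\<close> by simp
  qed
  have sq: "(?x (n + p))\<^sup>2 = (?x n)\<^sup>2"
    using N unfolding n add_Suc quad_iter_Suc by simp
  then have opposite: "?x (n + p) = - ?x n"
    using least[of n] n by (simp add: power2_eq_iff)
  have start: "quad_param_deriv c (N + p) 0 \<noteq> quad_param_deriv c N 0"
  proof
    assume eq: "quad_param_deriv c (N + p) 0 = quad_param_deriv c N 0"
    have "?x n * (quad_param_deriv c (n + p) 0 + quad_param_deriv c n 0) = 0"
      using eq opposite by (simp add: n algebra_simps add_eq_0_iff)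
    then have "quad_param_deriv c (n + p) 0 + quad_param_deriv c n 0 = 0"
      using nonzero[of n] \<open>n \<noteq> 0\<close> by simp
    moreover have "eval_int (pderiv (crit_poly (n + p)) + pderiv (crit_poly n)) c \<noteq> 0"
      using opposite N \<open>n \<noteq> 0\<close> \<open>p \<ge> 1\<close> unfolding n
      by (intro transversality_first_return) auto
    ultimately show False
      by (simp add: quad_param_deriv_critical eval_int_hom)
  qed
  have "?x (m + N + p) = ?x (m + N) \<and>
      quad_param_deriv c (m + N + p) 0 \<noteq> quad_param_deriv c (m + N) 0" for m
  proof (induction m)
    case 0
    then show ?case using N start by simp
  next
    case (Suc m)
    then show ?case using nonzero[of "m + N"] \<open>N \<noteq> 0\<close> by simp
  qed
  from this[of "L - N"] show ?thesis using NL by simp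
qed

section \<open>The filled Julia set has empty interior\<close>

text \<open>
  Pulling back step by step needs a square root of \<open>g - c\<close> each time. It exists on a simply connected
  region that avoids the postcritical set, and its sign can be chosen to hit the prescribed point.
\<close>

lemma quad_inverse_branch:
  assumes S: "open S" "simply_connected S" and "x0 \<in> S"
    and post: "\<And>j. (quad c ^^ Suc j) 0 \<notin> S"
    and "(quad c ^^ n) z = x0"
  obtains g where "g holomorphic_on S" "\<And>x. x \<in> S \<Longrightarrow> (quad c ^^ n) (g x) = x" "g x0 = z"
  using \<open>(quad c ^^ n) z = x0\<close>
proof (induction n arbitrary: z thesis)
  case 0
  show ?case by (rule 0(1)[of "\<lambda>x. x"]) (use 0 in auto)
next
  case (Suc n)
  have "(quad c ^^ n) (quad c z) = x0"
    using Suc.prems(2) by (simp add: funpow_swap1)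
  then obtain g where g: "g holomorphic_on S" "\<And>x. x \<in> S \<Longrightarrow> (quad c ^^ n) (g x) = x" "g x0 = quad c z"
    using Suc.IH by blast
  have "g x - c \<noteq> 0" if "x \<in> S" for x
  proof
    assume "g x - c = 0"
    then have "x = (quad c ^^ n) (quad c 0)" using g(2)[OF that] by (simp add: quad_def)
    then have "x = (quad c ^^ Suc n) 0" by (simp add: funpow_swap1)
    then show False using post that by blast
  qed
  moreover have "(\<lambda>x. g x - c) holomorphic_on S" by (intro holomorphic_intros g)
  ultimately obtain h where h: "h holomorphic_on S" "\<And>x. x \<in> S \<Longrightarrow> g x - c = (h x)\<^sup>2"
    using simply_connected_imp_holomorphic_sqrt[of "\<lambda>x. g x - c" S] S
      open_imp_locally_path_connected by blast
  define s :: complex where "s = (if h x0 = z then 1 else -1)"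
  have "(h x0)\<^sup>2 = z\<^sup>2"
    using h(2)[OF \<open>x0 \<in> S\<close>] g(3) by (simp add: quad_def)
  then have "s * h x0 = z" unfolding s_def power2_eq_iff by auto
  moreover have "(quad c ^^ Suc n) (s * h x) = x" if "x \<in> S" for x
  proof -
    have "quad c (s * h x) = g x"
      using h(2)[OF that] by (simp add: quad_def s_def power_mult_distrib diff_eq_eq)
    then show ?thesis using g(2)[OF that] by (simp add: funpow_swap1)
  qed
  ultimately show ?case
    by (intro Suc.prems(1)[of "\<lambda>x. s * h x"] holomorphic_intros h)
qed

text \<open>
  Cutting the rays that emanate from the points of \<open>P\<close> in the direction away from \<open>y\<close> leaves a region
  that is star-shaped around \<open>y\<close>. In contrast to a disk avoiding \<open>P\<close>, it contains points of large
  modulus.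
\<close>

lemma starlike_minus_rays:
  fixes y :: complex
  assumes "finite P" "y \<notin> P" "R > 0"
  defines "S \<equiv> ball y R - (\<Union>p\<in>P. (\<lambda>t. y + t *\<^sub>R (p - y)) ` {1..})"
  shows "open S" "starlike S" "y \<in> S" "P \<inter> S = {}"
proof -
  have "closed ((\<lambda>t. y + t *\<^sub>R (p - y)) ` {1..})" if "p \<in> P" for p
  proof -
    have "closed ((\<lambda>t::real. t *\<^sub>R (p - y)) ` {1..})"
      using that \<open>y \<notin> P\<close> by (intro closed_injective_linear_image linear_scaleR_left) (auto intro!: injI)
    then have "closed ((+) y ` (\<lambda>t::real. t *\<^sub>R (p - y)) ` {1..})"
      by (rule closed_translation)
    then show ?thesis by (simp add: image_image)
  qed
  then show "open S"
    unfolding S_def by (intro open_Diff closed_UN assms) auto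
  have "y \<noteq> y + t *\<^sub>R (p - y)" if "p \<in> P" "t \<ge> 1" for p and t :: real
    using that \<open>y \<notin> P\<close> by auto
  then show yS: "y \<in> S" using \<open>R > 0\<close> unfolding S_def by auto
  have "p \<in> (\<lambda>t. y + t *\<^sub>R (p - y)) ` {1..}" for p
    by (intro image_eqI[of _ _ 1]) auto
  then show "P \<inter> S = {}" unfolding S_def by blast
  have "closed_segment y x \<subseteq> S" if x: "x \<in> S" for x
  proof
    fix v assume v: "v \<in> closed_segment y x"
    then obtain u where u: "0 \<le> u" "u \<le> 1" "v = y + u *\<^sub>R (x - y)"
      by (auto simp: in_segment algebra_simps)
    have "v \<in> ball y R"
    proof -
      have "closed_segment y x \<subseteq> ball y R"
        using x \<open>R > 0\<close> by (intro closed_segment_subset) (auto simp: S_def)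
      then show ?thesis using v by blast
    qed
    moreover have False if "p \<in> P" "t \<ge> 1" "v = y + t *\<^sub>R (p - y)" for p and t :: real
    proof -
      have eq: "u *\<^sub>R (x - y) = t *\<^sub>R (p - y)" using u that by simp
      then have "u \<noteq> 0" using that \<open>y \<notin> P\<close> by auto
      then have "x = y + (t / u) *\<^sub>R (p - y)"
        using arg_cong[OF eq, of "\<lambda>v. inverse u *\<^sub>R v"] by (simp add: divide_inverse algebra_simps)
      moreover have "t / u \<ge> 1" using u that \<open>u \<noteq> 0\<close> by (simp add: field_simps)
      ultimately show False using x that unfolding S_def by blast
    qed
    ultimately show "v \<in> S" unfolding S_def by blast
  qed
  then show "starlike S" unfolding starlike_def using yS by blast
qed

text \<open>
  Each ray has only one slope, so among the points \<open>y + \<rho> * (1 + \<i> * t)\<close> with \<open>0 < t < 1\<close> only finitely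
  many are removed.
\<close>

lemma minus_rays_reaches_far:
  fixes y :: complex
  assumes "finite P" and "b \<ge> 0"
  shows "\<exists>x\<in>ball y (3 * (norm y + b + 1)) - (\<Union>p\<in>P. (\<lambda>t. y + t *\<^sub>R (p - y)) ` {1..}). norm x > b"
proof -
  define \<rho> where "\<rho> = norm y + b + 1"
  have \<rho>: "\<rho> > 0" using assms by (simp add: \<rho>_def add_nonneg_pos)
  let ?T = "{0<..<1::real} - (\<lambda>p. Im (p - y) / Re (p - y)) ` P"
  have "infinite ?T"
    using assms infinite_Ioo[of "0::real" 1] by (intro Diff_infinite_finite) auto
  then have "?T \<noteq> {}" by (rule infinite_imp_nonempty)
  then obtain t where "t \<in> ?T" by blast
  then have t: "0 < t" "t < 1" "t \<notin> (\<lambda>p. Im (p - y) / Re (p - y)) ` P"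
    by auto
  define v where "v = \<rho> *\<^sub>R Complex 1 t"
  have "norm (Complex 1 t) \<ge> 1" using complex_Re_le_cmod[of "Complex 1 t"] by simp
  moreover have "norm (Complex 1 t) < 3" using cmod_le[of "Complex 1 t"] t by simp
  ultimately have v: "norm v \<ge> \<rho>" "norm v < 3 * \<rho>"
    using \<rho> by (simp_all add: v_def mult.commute)
  have "norm (y + v) > b"
    using v norm_triangle_ineq2[of v "- y"] by (simp add: \<rho>_def add.commute)
  moreover have "y + v \<in> ball y (3 * \<rho>)" using v by (simp add: dist_norm)
  moreover have False if "p \<in> P" "y + v = y + s *\<^sub>R (p - y)" for p s
  proof -
    have eqv: "v = s *\<^sub>R (p - y)" using that(2) by simp
    have re: "s * Re (p - y) = \<rho>" and im: "s * Im (p - y) = \<rho> * t"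
      using arg_cong[OF eqv, of Re] arg_cong[OF eqv, of Im] by (auto simp: v_def)
    have "s \<noteq> 0" using re \<rho> by auto
    then have "Im (p - y) / Re (p - y) = (s * Im (p - y)) / (s * Re (p - y))" by simp
    also have "\<dots> = t" unfolding re im using \<rho> by simp
    finally have "t = Im (p - y) / Re (p - y)" ..
    then show False using t that(1) by blast
  qed
  ultimately show ?thesis unfolding \<rho>_def[symmetric] by blast
qed

lemma countable_quad_preimages: "countable {z. \<exists>n. (quad c ^^ n) z = a}"
proof -
  have "finite {z. (quad c ^^ n) z = a}" for n
  proof (induction n)
    case (Suc n)
    have "{z. (quad c ^^ Suc n) z = a}
        \<subseteq> (\<Union>b\<in>{z. (quad c ^^ n) z = a}. {csqrt (b - c), - csqrt (b - c)})"
    proof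
      fix z assume "z \<in> {z. (quad c ^^ Suc n) z = a}"
      then have "(quad c ^^ n) (quad c z) = a" by (simp add: funpow_swap1)
      moreover have "z\<^sup>2 = (csqrt (quad c z - c))\<^sup>2" by (simp add: quad_def)
      ultimately show "z \<in> (\<Union>b\<in>{z. (quad c ^^ n) z = a}. {csqrt (b - c), - csqrt (b - c)})"
        unfolding power2_eq_iff by blast
    qed
    then show ?case by (rule finite_subset) (use Suc in auto)
  qed simp
  then have "countable (\<Union>n. {z. (quad c ^^ n) z = a})"
    by (intro countable_UN) (auto intro: countable_finite)
  then show ?thesis by (simp add: Collect_ex_eq)
qed

lemma repelling_fixed_point_expands:
  fixes G :: "complex \<Rightarrow> complex"
  assumes "(G has_field_derivative l) (at a)" "norm l > 1" "G a = a"
  obtains s \<mu> where "s > 0" "\<mu> > 1" "\<And>x. dist x a < s \<Longrightarrow> dist (G x) a \<ge> \<mu> * dist x a"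
proof -
  define \<mu> where "\<mu> = (1 + norm l) / 2"
  have \<mu>: "1 < \<mu>" "\<mu> < norm l" using assms(2) by (simp_all add: \<mu>_def)
  have "((\<lambda>x. norm ((G x - G a) / (x - a))) \<longlongrightarrow> norm l) (at a)"
    using assms(1) unfolding has_field_derivative_iff by (intro tendsto_norm)
  then have "\<forall>\<^sub>F x in at a. norm ((G x - G a) / (x - a)) > \<mu>"
    using \<mu>(2) by (rule order_tendstoD)
  then obtain s where s: "s > 0" "\<And>x. x \<noteq> a \<Longrightarrow> dist x a < s \<Longrightarrow> norm ((G x - G a) / (x - a)) > \<mu>"
    unfolding eventually_at by blast
  have "dist (G x) a \<ge> \<mu> * dist x a" if "dist x a < s" for x
  proof (cases "x = a")
    case False
    then have "norm (G x - a) / norm (x - a) > \<mu>"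
      using s(2)[OF False that] assms(3) by (simp add: norm_divide)
    then show ?thesis using False by (simp add: dist_norm field_simps)
  qed (simp add: assms(3))
  then show ?thesis using that s(1) \<mu>(1) by blast
qed

text \<open>
  An orbit that accumulates at the postcritical set accumulates at the repelling point \<open>a\<close>. As it
  never hits \<open>a\<close>, it is pushed away from \<open>a\<close> each time it comes close, and passes through an
  annulus around \<open>a\<close> that contains no postcritical point. So it accumulates in this annulus.
\<close>

lemma orbit_accumulates_off_postcritical:
  fixes c :: complex and L p :: nat
  defines "a \<equiv> (quad c ^^ L) 0"
  defines "P \<equiv> range (\<lambda>j. (quad c ^^ Suc j) 0)"
  assumes per: "(quad c ^^ p) a = a" and "p \<ge> 1" and rep: "norm (quad_deriv c p a) > 1"
    and "finite P" and z: "z \<in> filled_julia c" and avoid: "\<And>n. (quad c ^^ n) z \<noteq> a"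
  obtains y r where "strict_mono r" "(\<lambda>k. (quad c ^^ r k) z) \<longlonglongrightarrow> y" "y \<notin> P"
proof -
  let ?z = "\<lambda>n. (quad c ^^ n) z"
  have bdd: "bounded (range (\<lambda>k. ?z (r k)))" for r :: "nat \<Rightarrow> nat"
    using z unfolding filled_julia_iff bounded_iff by blast
  obtain y r where r: "strict_mono r" "(\<lambda>k. ?z (r k)) \<longlonglongrightarrow> y"
    using bounded_imp_convergent_subsequence[OF bdd[of "\<lambda>k. k"]] by (auto simp: comp_def)
  show thesis
  proof (cases "y \<in> P")
    case False
    then show ?thesis using that r by blast
  next
    case True
    then obtain j where j: "y = (quad c ^^ Suc j) 0" by (auto simp: P_def)
    \<comment> \<open>A number of steps from \<open>y\<close> to \<open>a\<close>: the orbit is at \<open>a\<close> at time \<open>L\<close> plus any multiple of \<open>p\<close>.\<close>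
    define m where "m = L + p * Suc j - Suc j"
    have "1 * Suc j \<le> p * Suc j" using \<open>p \<ge> 1\<close> by (rule mult_right_mono) simp
    then have m: "m + Suc j = p * Suc j + L" unfolding m_def
      by (subst le_add_diff_inverse2) (simp_all only: mult_1 trans_le_add2 add.commute)
    have "((quad c ^^ p) ^^ i) a = a" for i
      using per by (induction i) simp_all
    then have "(quad c ^^ m) y = a"
      unfolding j quad_iter_add[symmetric] m a_def
      by (simp only: quad_iter_add funpow_mult[symmetric])
    moreover have "(\<lambda>k. (quad c ^^ m) (?z (r k))) \<longlonglongrightarrow> (quad c ^^ m) y"
      by (intro tendsto_intros r)
    ultimately have lim: "(\<lambda>k. ?z (m + r k)) \<longlonglongrightarrow> a"
      by (simp add: quad_iter_add)
    define G where "G = quad c ^^ p"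
    obtain s\<^sub>0 \<mu> where s0: "s\<^sub>0 > 0" "\<mu> > 1" "\<And>x. dist x a < s\<^sub>0 \<Longrightarrow> dist (G x) a \<ge> \<mu> * dist x a"
      using repelling_fixed_point_expands[of G _ a] has_field_derivative_quad_iter[where c = c and n = p and z = a] rep per
      unfolding G_def by blast
    obtain s\<^sub>1 where s1: "s\<^sub>1 > 0" "\<And>x. x \<in> P \<Longrightarrow> x \<noteq> a \<Longrightarrow> s\<^sub>1 < dist a x"
    proof -
      obtain d where "d > 0" "\<forall>x\<in>P. x \<noteq> a \<longrightarrow> d \<le> dist a x"
        using finite_set_avoid[OF \<open>finite P\<close>] by blast
      then show ?thesis by (intro that[of "d / 2"]) force+
    qed
    have "isCont G a"
      unfolding G_def using has_field_derivative_quad_iter by (rule DERIV_isCont)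
    then obtain s\<^sub>2 where s2: "s\<^sub>2 > 0" "\<And>x. dist x a < s\<^sub>2 \<Longrightarrow> dist (G x) (G a) < s\<^sub>1"
      using s1(1) unfolding continuous_at_eps_delta by blast
    have Ga: "G a = a" using per by (simp add: G_def)
    define s where "s = min s\<^sub>0 s\<^sub>2"
    have s: "s > 0" using s0 s2 by (simp add: s_def)
    let ?A = "{x. s \<le> dist x a \<and> dist x a \<le> s\<^sub>1}"
    have "closed ?A" by (intro closed_Collect_conj closed_Collect_le continuous_intros)
    have exits: "\<exists>i. ?z (p * i + n) \<in> ?A" if n: "dist (?z n) a < s" for n
    proof -
      have iter: "(G ^^ i) (?z n) = ?z (p * i + n)" for i
        by (simp add: G_def funpow_mult quad_iter_add)
      have "\<exists>i. dist ((G ^^ i) (?z n)) a \<ge> s"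
      proof (rule ccontr)
        assume "\<not> (\<exists>i. dist ((G ^^ i) (?z n)) a \<ge> s)"
        then have small: "dist ((G ^^ i) (?z n)) a < s" for i by (simp add: not_le)
        have grow: "dist ((G ^^ i) (?z n)) a \<ge> \<mu> ^ i * dist (?z n) a" for i
        proof (induction i)
          case (Suc i)
          have "\<mu> * (\<mu> ^ i * dist (?z n) a) \<le> \<mu> * dist ((G ^^ i) (?z n)) a"
            using Suc s0(2) by (intro mult_left_mono) auto
          also have "\<dots> \<le> dist (G ((G ^^ i) (?z n))) a"
            using small[of i] by (intro s0(3)) (simp add: s_def)
          finally show ?case by (simp add: mult.assoc)
        qed simp
        have pos: "dist (?z n) a > 0" using avoid by simp
        obtain i where "\<mu> ^ i > s / dist (?z n) a"
          using real_arch_pow[OF s0(2)] by blast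
        then have "\<mu> ^ i * dist (?z n) a > s" using pos by (simp add: field_simps)
        then show False using grow[of i] small[of i] by linarith
      qed
      then obtain i where i: "dist ((G ^^ i) (?z n)) a \<ge> s"
        and least: "\<And>i'. i' < i \<Longrightarrow> \<not> dist ((G ^^ i') (?z n)) a \<ge> s"
        using exists_least_iff[of "\<lambda>i. dist ((G ^^ i) (?z n)) a \<ge> s"] by blast
      obtain i' where i': "i = Suc i'" using i n by (cases i) auto
      have "dist (G ((G ^^ i') (?z n))) (G a) < s\<^sub>1"
        using least[of i'] i' by (intro s2(2)) (simp add: s_def not_le)
      then have "?z (p * i + n) \<in> ?A"
        using i unfolding mem_Collect_eq iter[symmetric] i' Ga by simp
      then show ?thesis by blast
    qed
    have "\<exists>n'\<ge>n. ?z n' \<in> ?A" for n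
    proof -
      have "\<forall>\<^sub>F k in sequentially. dist (?z (m + r k)) a < s"
        using lim s by (rule tendstoD)
      then obtain k0 where k0: "\<forall>k\<ge>k0. dist (?z (m + r k)) a < s"
        unfolding eventually_sequentially by blast
      define k where "k = max k0 n"
      have "dist (?z (m + r k)) a < s" using k0 by (simp add: k_def)
      then obtain i where "?z (p * i + (m + r k)) \<in> ?A" using exits by blast
      moreover have "p * i + (m + r k) \<ge> n"
        using seq_suble[OF r(1), of k] by (simp add: k_def)
      ultimately show ?thesis by blast
    qed
    then have "infinite {n. ?z n \<in> ?A}"
      unfolding infinite_nat_iff_unbounded_le by blast
    then obtain t :: "nat \<Rightarrow> nat" where t: "strict_mono t" "\<And>k. ?z (t k) \<in> ?A"
      using infinite_enumerate by blast
    obtain y' r' where r': "strict_mono r'" "(\<lambda>k. ?z (t (r' k))) \<longlonglongrightarrow> y'"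
      using bounded_imp_convergent_subsequence[OF bdd[of t]] by (auto simp: comp_def)
    have "y' \<in> ?A"
      using closed_sequentially[OF \<open>closed ?A\<close> _ r'(2)] t(2) by blast
    moreover from this have "y' \<noteq> a" using s by auto
    ultimately have "y' \<notin> P" using s1(2)[of y'] by (auto simp: dist_commute)
    moreover have "strict_mono (t \<circ> r')" using t(1) r'(1) by (rule strict_mono_o)
    ultimately show ?thesis using that[of "t \<circ> r'" y'] r'(2) by (simp add: comp_def)
  qed
qed

lemma finite_postcritical:
  assumes per: "(quad c ^^ p) ((quad c ^^ L) 0) = (quad c ^^ L) 0" and "p \<ge> 1"
  shows "finite (range (\<lambda>j. (quad c ^^ Suc j) 0))"
proof -
  have "(quad c ^^ n) 0 \<in> (\<lambda>j. (quad c ^^ j) 0) ` {..<L + p}" for n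
  proof (cases "n < L")
    case False
    then have "(quad c ^^ n) 0 = (quad c ^^ (n - L)) ((quad c ^^ L) 0)"
      by (simp add: quad_iter_add[symmetric])
    also have "\<dots> = (quad c ^^ ((n - L) mod p)) ((quad c ^^ L) 0)"
      using funpow_mod_eq[OF per] by metis
    also have "\<dots> = (quad c ^^ ((n - L) mod p + L)) 0"
      by (simp add: quad_iter_add)
    finally have "(quad c ^^ n) 0 = (quad c ^^ ((n - L) mod p + L)) 0" .
    moreover have "(n - L) mod p + L < L + p" using \<open>p \<ge> 1\<close> by simp
    ultimately show ?thesis by blast
  qed auto
  then have "range (\<lambda>j. (quad c ^^ Suc j) 0) \<subseteq> (\<lambda>j. (quad c ^^ j) 0) ` {..<L + p}"
    by blast
  then show ?thesis by (rule finite_subset) simp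
qed

text \<open>
  Suppose the limit \<open>G\<close> is not constant. By Hurwitz's theorem, the branches take the value \<open>G x0\<close>
  near \<open>x0\<close>, so arbitrarily high iterates of the point \<open>G x0\<close> lie in a small disk around \<open>x0\<close>.
  This disk lies outside the filled Julia set, so the orbit of \<open>G x0\<close> has to be unbounded and must
  leave the disk for good.
\<close>

lemma inverse_branches_limit_constant:
  fixes r :: "nat \<Rightarrow> nat"
  assumes S: "open S" "connected S" and "strict_mono r"
    and hol: "\<And>k. g k holomorphic_on S"
    and inv: "\<And>k x. x \<in> S \<Longrightarrow> (quad c ^^ r k) (g k x) = x"
    and holG: "G holomorphic_on S"
    and lim: "\<And>K. compact K \<Longrightarrow> K \<subseteq> S \<Longrightarrow> uniform_limit K g G sequentially"
    and far: "x0 \<in> S" "x0 \<notin> filled_julia c"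
  shows "G constant_on S"
proof (rule ccontr)
  assume nonconst: "\<not> G constant_on S"
  have "open (S - filled_julia c)"
    using S closed_filled_julia by (intro open_Diff)
  then obtain s where s: "s > 0" "ball x0 s \<subseteq> S - filled_julia c"
    using far open_contains_ball by (metis DiffI)
  have nonconst_ball: "\<not> (\<lambda>x. G x - G x0) constant_on ball x0 s"
  proof
    assume "(\<lambda>x. G x - G x0) constant_on ball x0 s"
    then obtain b where b: "\<And>x. x \<in> ball x0 s \<Longrightarrow> G x - G x0 = b"
      unfolding constant_on_def by blast
    have "G x = G x0 + b" if "x \<in> S" for x
    proof (rule analytic_continuation_open[of "ball x0 s" S G "\<lambda>_. G x0 + b" x])
      show "G y = G x0 + b" if "y \<in> ball x0 s" for y
        using b[OF that] by (simp add: algebra_simps)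
    qed (use S s that holG in auto)
    then show False using nonconst unfolding constant_on_def by blast
  qed
  have hit: "\<exists>k\<ge>N. \<exists>x\<in>ball x0 s. g k x = G x0" for N
  proof (rule ccontr)
    assume none: "\<not> (\<exists>k\<ge>N. \<exists>x\<in>ball x0 s. g k x = G x0)"
    have "G x0 - G x0 \<noteq> 0"
    proof (rule Hurwitz_no_zeros[of "ball x0 s" "\<lambda>k x. g (k + N) x - G x0" "\<lambda>x. G x - G x0"])
      show "(\<lambda>x. g (k + N) x - G x0) holomorphic_on ball x0 s" for k
        using s hol[of "k + N"] by (intro holomorphic_intros) (auto elim: holomorphic_on_subset)
      show "(\<lambda>x. G x - G x0) holomorphic_on ball x0 s"
        using s holG by (intro holomorphic_intros) (auto elim: holomorphic_on_subset)
      show "uniform_limit K (\<lambda>k x. g (k + N) x - G x0) (\<lambda>x. G x - G x0) sequentially"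
        if "compact K" "K \<subseteq> ball x0 s" for K
      proof -
        have "uniform_limit K g G sequentially" using that s by (intro lim) auto
        then have "uniform_limit K (\<lambda>k. g (k + N)) G sequentially"
          by (rule filterlim_compose[OF _ filterlim_add_const_nat_at_top])
        then show ?thesis by (intro uniform_limit_intros)
      qed
      show "g (k + N) x - G x0 \<noteq> 0" if "x \<in> ball x0 s" for k x
        using none that by auto
    qed (use s nonconst_ball in auto)
    then show False by simp
  qed
  have image: "\<exists>k\<ge>N. (quad c ^^ r k) (G x0) \<in> ball x0 s" for N
    using hit[of N] inv s by (metis DiffD1 subsetD)
  have "G x0 \<notin> filled_julia c"
    using image[of 0] s quad_iter_in_filled_julia_iff by (metis DiffD2 subsetD)
  then obtain N where N: "\<And>n. n \<ge> N \<Longrightarrow> norm ((quad c ^^ n) (G x0)) \<ge> norm x0 + s"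
    using escapes_if_not_filled_julia by blast
  obtain k where k: "k \<ge> N" "(quad c ^^ r k) (G x0) \<in> ball x0 s" using image by blast
  have "norm ((quad c ^^ r k) (G x0)) < norm x0 + s"
    using k(2) norm_triangle_sub[of "(quad c ^^ r k) (G x0)" x0] by (simp add: dist_norm norm_minus_commute)
  moreover have "r k \<ge> N" using seq_suble[OF \<open>strict_mono r\<close>, of k] k(1) by simp
  ultimately show False using N[of "r k"] by simp
qed

text \<open>
  Take a point \<open>z\<close> of the interior whose orbit never hits the repelling cycle and let \<open>y\<close> be an
  accumulation point outside of the postcritical set. The inverse branches that lead from near \<open>y\<close>
  back to \<open>z\<close> extend to a star-shaped region that reaches beyond the filled Julia set, so their limits
  are constant and their derivatives tend to \<open>0\<close>. But iterates are bounded near \<open>z\<close>, so their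
  derivatives at \<open>z\<close> cannot tend to infinity.
\<close>

theorem filled_julia_interior_empty:
  fixes c :: complex and L p :: nat
  defines "a \<equiv> (quad c ^^ L) 0"
  assumes per: "(quad c ^^ p) a = a" and "p \<ge> 1" and rep: "norm (quad_deriv c p a) > 1"
  shows "interior (filled_julia c) = {}"
proof (rule ccontr)
  let ?K = "filled_julia c"
  let ?P = "range (\<lambda>j. (quad c ^^ Suc j) 0)"
  assume "interior ?K \<noteq> {}"
  then obtain z0 d0 where z0: "d0 > 0" "ball z0 d0 \<subseteq> ?K"
    using mem_interior by blast
  obtain z where z: "z \<in> ball z0 d0" "\<And>n. (quad c ^^ n) z \<noteq> a"
    using ball_minus_countable_nonempty[OF countable_quad_preimages[of c a] z0(1), of z0] by blast
  obtain \<delta> where \<delta>: "\<delta> > 0" "ball z \<delta> \<subseteq> ?K"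
    using z(1) z0(2) open_contains_ball[of "ball z0 d0"] by (meson open_ball subset_trans)
  have finP: "finite ?P"
    using per \<open>p \<ge> 1\<close> unfolding a_def by (rule finite_postcritical)
  obtain y r where r: "strict_mono r" "(\<lambda>k. (quad c ^^ r k) z) \<longlonglongrightarrow> y" "y \<notin> ?P"
    using orbit_accumulates_off_postcritical[where c = c and p = p and L = L and z = z] per \<open>p \<ge> 1\<close> rep finP z \<delta> 
    unfolding a_def by (metis centre_in_ball subsetD)
  define R where "R = 3 * (norm y + (norm c + 2) + 1)"
  have R: "R > 0" by (simp add: R_def add_pos_nonneg)
  define S where "S = ball y R - (\<Union>p\<in>?P. (\<lambda>t. y + t *\<^sub>R (p - y)) ` {1..})"
  have S: "open S" "starlike S" "y \<in> S" "?P \<inter> S = {}"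
    using starlike_minus_rays[OF finP r(3) R] unfolding S_def by blast+
  obtain x0 where x0: "x0 \<in> S" "norm x0 > norm c + 2"
    using minus_rays_reaches_far[OF finP, of "norm c + 2" y] unfolding S_def R_def by auto
  have x0K: "x0 \<notin> ?K"
    using x0(2) unfolding filled_julia_iff by (metis funpow_0 not_le)
  obtain \<epsilon> where \<epsilon>: "\<epsilon> > 0" "cball y \<epsilon> \<subseteq> S"
    using S open_contains_cball by blast
  have "\<forall>\<^sub>F k in sequentially. dist ((quad c ^^ r k) z) y < \<epsilon> / 2"
    using r(2) \<epsilon>(1) by (intro tendstoD) auto
  then obtain k0 where k0: "\<And>k. k \<ge> k0 \<Longrightarrow> dist ((quad c ^^ r k) z) y < \<epsilon> / 2"
    unfolding eventually_sequentially by blast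
  \<comment> \<open>Discard the times at which the orbit is not yet close to \<open>y\<close>.\<close>
  define n where "n k = r (k + k0)" for k
  have n: "strict_mono n" using r(1) by (simp add: n_def strict_mono_def)
  define x where "x k = (quad c ^^ n k) z" for k
  have x: "dist (x k) y < \<epsilon> / 2" for k using k0[of "k + k0"] by (simp add: x_def n_def)
  have xS: "x k \<in> S" for k using x[of k] \<epsilon> by (auto simp: dist_commute)
  have "\<exists>g. g holomorphic_on S \<and> (\<forall>u\<in>S. (quad c ^^ n k) (g u) = u) \<and> g (x k) = z" for k
    by (rule quad_inverse_branch[OF S(1) starlike_imp_simply_connected[OF S(2)] xS[of k], of c "n k" z])
       (use S(4) in \<open>auto simp: x_def\<close>)
  then obtain g where g: "\<And>k. g k holomorphic_on S" "\<And>k u. u \<in> S \<Longrightarrow> (quad c ^^ n k) (g k u) = u"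
      "\<And>k. g k (x k) = z"
    by metis
  define B where "B = norm c + 2 + norm y + R"
  have gB: "norm (g k u) \<le> B" if "u \<in> S" for k u
  proof (cases "norm (g k u) \<ge> norm c + 2")
    case True
    then have "norm (g k u) \<le> norm ((quad c ^^ n k) (g k u))" by (rule quad_iter_norm_ge)
    also have "\<dots> = norm u" using g(2)[OF that] by simp
    also have "\<dots> \<le> norm y + R"
      using that norm_triangle_sub[of u y] by (auto simp: S_def dist_norm norm_minus_commute)
    finally show ?thesis using norm_ge_zero[of c] unfolding B_def by linarith
  next
    case False
    then show ?thesis using R norm_ge_zero[of y] unfolding B_def by linarith
  qed
  obtain G t where G: "G holomorphic_on S" "strict_mono (t :: nat \<Rightarrow> nat)"
      "\<And>K. compact K \<Longrightarrow> K \<subseteq> S \<Longrightarrow> uniform_limit K (g \<circ> t) G sequentially"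
  proof (rule Montel[of S "{h. h holomorphic_on S \<and> (\<forall>u\<in>S. norm (h u) \<le> B)}" g])
    show "\<exists>B. \<forall>h\<in>{h. h holomorphic_on S \<and> (\<forall>u\<in>S. norm (h u) \<le> B')}. \<forall>z\<in>K. norm (h z) \<le> B"
      if "K \<subseteq> S" for K B'
      using that by blast
  qed (use S g gB that in auto)
  have "G constant_on S"
  proof (rule inverse_branches_limit_constant)
    show "strict_mono (\<lambda>k. n (t k))" using n G(2) by (simp add: strict_mono_def)
    show "connected S" using S(2) by (rule starlike_imp_connected)
    show "uniform_limit K (\<lambda>k. g (t k)) G sequentially" if "compact K" "K \<subseteq> S" for K
      using G(3)[OF that] by (simp add: comp_def)
    show "(quad c ^^ n (t k)) (g (t k) u) = u" if "u \<in> S" for k u using that by (rule g(2))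
  qed (use S g(1) G(1) x0 x0K in auto)
  then obtain b where b: "\<And>u. u \<in> S \<Longrightarrow> G u = b" unfolding constant_on_def by blast
  \<comment> \<open>Cauchy's estimate on the disk around \<open>z\<close> keeps the derivatives of all iterates at \<open>z\<close>
    bounded, so the inverse branches cannot contract there.\<close>
  define D where "D = (norm c + 2) / (\<delta> / 2)"
  have D: "D > 0" using \<delta> by (simp add: D_def add_nonneg_pos)
  have fD: "norm (deriv (quad c ^^ m) z) \<le> D" for m
  proof -
    have "norm ((deriv ^^ 1) (quad c ^^ m) z) \<le> fact 1 * (norm c + 2) / (\<delta> / 2) ^ 1"
    proof (rule Cauchy_inequality)
      have "(quad c ^^ m) holomorphic_on UNIV"
        using holomorphic_on_quad_iter[of "\<lambda>_. c" UNIV "\<lambda>z. z" m] by simp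
      then show "(quad c ^^ m) holomorphic_on ball z (\<delta> / 2)"
        "continuous_on (cball z (\<delta> / 2)) (quad c ^^ m)"
        by (meson holomorphic_on_imp_continuous_on holomorphic_on_subset subset_UNIV)+
      show "norm ((quad c ^^ m) v) \<le> norm c + 2" if "norm (z - v) = \<delta> / 2" for v
      proof -
        have "v \<in> ?K" using that \<delta> by (auto simp: dist_norm)
        then show ?thesis unfolding filled_julia_iff by blast
      qed
    qed (use \<delta> in simp)
    then show ?thesis by (simp add: D_def)
  qed
  have gD: "norm (deriv (g k) (x k)) \<ge> 1 / D" for k
  proof -
    have "((quad c ^^ n k) has_field_derivative deriv (quad c ^^ n k) z) (at (g k (x k)))"
      unfolding g(3) by (metis DERIV_imp_deriv has_field_derivative_quad_iter)
    moreover have "(g k has_field_derivative deriv (g k) (x k)) (at (x k))"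
      using g(1) S(1) xS by (rule holomorphic_derivI)
    ultimately have "(((quad c ^^ n k) \<circ> g k) has_field_derivative
        deriv (quad c ^^ n k) z * deriv (g k) (x k)) (at (x k))"
      by (rule DERIV_chain)
    then have "((\<lambda>u. u) has_field_derivative deriv (quad c ^^ n k) z * deriv (g k) (x k)) (at (x k))"
      by (rule has_field_derivative_transform_within_open[OF _ S(1) xS]) (simp add: g(2))
    then have "deriv (quad c ^^ n k) z * deriv (g k) (x k) = 1"
      using DERIV_ident DERIV_unique by blast
    then have "1 = norm (deriv (quad c ^^ n k) z) * norm (deriv (g k) (x k))"
      by (metis norm_mult norm_one)
    also have "\<dots> \<le> D * norm (deriv (g k) (x k))"
      by (intro mult_right_mono fD) auto
    finally show ?thesis using D by (simp add: field_simps)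
  qed
  have "\<forall>\<^sub>F k in sequentially. \<forall>u\<in>cball y \<epsilon>. dist ((g \<circ> t) k u) (G u) < \<epsilon> / (4 * D)"
    using G(3)[of "cball y \<epsilon>"] \<epsilon> D unfolding uniform_limit_iff by auto
  then obtain k where "\<forall>u\<in>cball y \<epsilon>. dist ((g \<circ> t) k u) (G u) < \<epsilon> / (4 * D)"
    unfolding eventually_sequentially by blast
  then have close: "norm (g (t k) u - b) < \<epsilon> / (4 * D)" if "u \<in> cball y \<epsilon>" for u
    using that b[of u] \<epsilon>(2) unfolding dist_norm comp_def by (metis subsetD)
  let ?x = "x (t k)"
  have sub: "cball ?x (\<epsilon> / 2) \<subseteq> cball y \<epsilon>"
  proof
    fix u assume "u \<in> cball ?x (\<epsilon> / 2)"
    then show "u \<in> cball y \<epsilon>"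
      using x[of "t k"] dist_triangle[of y u ?x] by (simp add: dist_commute)
  qed
  have "norm ((deriv ^^ 1) (\<lambda>u. g (t k) u - b) ?x) \<le> fact 1 * (\<epsilon> / (4 * D)) / (\<epsilon> / 2) ^ 1"
  proof (rule Cauchy_inequality)
    have hol: "(\<lambda>u. g (t k) u - b) holomorphic_on S" by (intro holomorphic_intros g)
    show "(\<lambda>u. g (t k) u - b) holomorphic_on ball ?x (\<epsilon> / 2)"
      using hol sub \<epsilon>(2) ball_subset_cball by (meson holomorphic_on_subset subset_trans)
    show "continuous_on (cball ?x (\<epsilon> / 2)) (\<lambda>u. g (t k) u - b)"
      using hol sub \<epsilon>(2) by (meson holomorphic_on_imp_continuous_on holomorphic_on_subset subset_trans)
    show "norm (g (t k) u - b) \<le> \<epsilon> / (4 * D)" if "norm (?x - u) = \<epsilon> / 2" for u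
    proof -
      have "u \<in> cball ?x (\<epsilon> / 2)" using that by (simp add: dist_norm)
      then show ?thesis using close sub by (meson less_imp_le subsetD)
    qed
  qed (use \<epsilon> in simp)
  moreover have "deriv (\<lambda>u. g (t k) u - b) ?x = deriv (g (t k)) ?x"
    using g(1)[of "t k"] S(1) xS[of "t k"] holomorphic_on_imp_differentiable_at
    by (subst deriv_diff) auto
  ultimately have "norm (deriv (g (t k)) ?x) \<le> 1 / (2 * D)"
    using \<epsilon> D by (simp add: field_simps)
  then have "1 / D \<le> 1 / (2 * D)" using gD[of "t k"] by linarith
  then show False using D by (simp add: field_simps)
qed

section \<open>The Poincare function and shadowing of its orbits\<close>

text \<open>
  An error that grows by the factor \<open>\<Lambda>\<close> in each of \<open>k\<close> steps, up to a relative perturbation of order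
  \<open>\<Lambda> ^ j / \<Lambda> ^ k\<close>, grows by \<open>\<Lambda> ^ k\<close> up to a factor that does not depend on \<open>k\<close>: the perturbations form a
  geometric series, dominated by the last steps. The recursion is only known to hold while the error
  stays below \<open>M * \<Lambda> ^ j / \<Lambda> ^ k\<close>; the smallness assumption on the start keeps it there.
\<close>

lemma discrete_gronwall:
  fixes d :: "nat \<Rightarrow> real"
  assumes L: "\<Lambda> > 1" and A: "A \<ge> 0" and b: "b \<ge> 0" and d: "\<And>j. d j \<ge> 0"
    and step: "\<And>j. j < k \<Longrightarrow> d j \<le> M * (\<Lambda> ^ j / \<Lambda> ^ k) \<Longrightarrow>
      d (Suc j) \<le> (\<Lambda> + A * (\<Lambda> ^ j / \<Lambda> ^ k)) * d j + b * (\<Lambda> ^ j / \<Lambda> ^ k)"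
    and M: "exp (A / (\<Lambda> - 1)) * (\<Lambda> ^ k * d 0 + k * b) \<le> M"
    and "j \<le> k"
  shows "d j \<le> exp (A / (\<Lambda> - 1)) * (\<Lambda> ^ k * d 0 + k * b) * (\<Lambda> ^ j / \<Lambda> ^ k)"
proof -
  define \<tau> where "\<tau> j = \<Lambda> ^ j / \<Lambda> ^ k" for j
  \<comment> \<open>The product of the first \<open>j\<close> perturbation factors is at most \<open>exp\<close> of the sum of a geometric
    series, which \<open>E\<close> expresses in closed form.\<close>
  define E where "E j = exp (A / (\<Lambda> - 1) * \<tau> j)" for j
  define X where "X j = \<Lambda> ^ k * d 0 + real j * b" for j
  have \<tau>: "\<tau> j > 0" for j using L by (simp add: \<tau>_def)
  have \<tau>1: "\<tau> j \<le> 1" if "j \<le> k" for j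
    using L that by (simp add: \<tau>_def power_increasing)
  have X: "X j \<ge> 0" for j using L b d by (simp add: X_def)
  have Xk: "X j \<le> X k" if "j \<le> k" for j using that b by (simp add: X_def mult_right_mono)
  have E1: "E j \<ge> 1" for j using A L \<tau>[of j] by (simp add: E_def)
  have Ek: "E j \<le> exp (A / (\<Lambda> - 1))" if "j \<le> k" for j
  proof -
    have "A / (\<Lambda> - 1) * \<tau> j \<le> A / (\<Lambda> - 1)"
      by (rule mult_left_le) (use \<tau>1[OF that] A L in auto)
    then show ?thesis unfolding E_def by simp
  qed
  have bound: "E j * X j * \<tau> j \<le> exp (A / (\<Lambda> - 1)) * X k * \<tau> j" if "j \<le> k" for j
    using Ek[OF that] Xk[OF that] X[of j] \<tau>[of j] E1[of j] by (intro mult_right_mono mult_mono) auto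
  have "d j \<le> E j * X j * \<tau> j" if "j \<le> k" for j
    using that
  proof (induction j)
    case 0
    have "d 0 \<le> E 0 * d 0" using E1[of 0] d[of 0] by (simp add: mult_le_cancel_right1)
    then show ?case using L by (simp add: X_def \<tau>_def)
  next
    case (Suc j)
    then have IH: "d j \<le> E j * X j * \<tau> j" by simp
    have Esuc: "E (Suc j) = E j * exp (A * \<tau> j)"
    proof -
      have "\<tau> (Suc j) = \<tau> j + (\<Lambda> - 1) * \<tau> j" by (simp add: \<tau>_def diff_divide_distrib algebra_simps)
      then have "A / (\<Lambda> - 1) * \<tau> (Suc j) = A / (\<Lambda> - 1) * \<tau> j + A * \<tau> j"
        using L by (simp add: field_simps)
      then show ?thesis by (simp add: E_def exp_add)
    qed
    have "exp (A / (\<Lambda> - 1)) * X k * \<tau> j \<le> M * \<tau> j"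
      using M \<tau>[of j] unfolding X_def by (intro mult_right_mono) auto
    then have "d j \<le> M * \<tau> j" using IH bound[of j] Suc.prems by simp
    then have "d (Suc j) \<le> (\<Lambda> + A * \<tau> j) * d j + b * \<tau> j"
      using step[of j] Suc.prems by (simp add: \<tau>_def)
    also have "\<dots> \<le> (\<Lambda> * exp (A * \<tau> j)) * (E j * X j * \<tau> j) + b * \<tau> j"
    proof (intro add_right_mono mult_mono IH)
      have "\<Lambda> + A * \<tau> j \<le> \<Lambda> * (1 + A * \<tau> j)"
        using mult_right_mono[of 1 \<Lambda> "A * \<tau> j"] L A \<tau>[of j] by (simp add: algebra_simps)
      also have "\<dots> \<le> \<Lambda> * exp (A * \<tau> j)"
        using L by (intro mult_left_mono exp_ge_add_one_self) auto
      finally show "\<Lambda> + A * \<tau> j \<le> \<Lambda> * exp (A * \<tau> j)" .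
    qed (use L d in auto)
    also have "\<dots> = E (Suc j) * X j * (\<Lambda> * \<tau> j) + b * \<tau> j"
      unfolding Esuc by (simp add: algebra_simps)
    also have "\<dots> \<le> E (Suc j) * X j * (\<Lambda> * \<tau> j) + E (Suc j) * b * (\<Lambda> * \<tau> j)"
    proof -
      have "1 * 1 \<le> E (Suc j) * \<Lambda>" using E1[of "Suc j"] L by (intro mult_mono) auto
      then have "1 * (b * \<tau> j) \<le> (E (Suc j) * \<Lambda>) * (b * \<tau> j)"
        using b \<tau>[of j] by (intro mult_right_mono) auto
      then show ?thesis by (simp add: algebra_simps)
    qed
    also have "\<dots> = E (Suc j) * X (Suc j) * \<tau> (Suc j)"
      by (simp add: X_def \<tau>_def algebra_simps)
    finally show ?case .
  qed
  then show ?thesis using bound[OF \<open>j \<le> k\<close>] \<open>j \<le> k\<close> unfolding X_def \<tau>_def by force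
qed

lemma entire_lipschitz_on_cball:
  assumes "h holomorphic_on UNIV"
  shows "\<exists>C\<ge>0. \<forall>x\<in>cball a r. \<forall>y\<in>cball a r. norm (h x - h y) \<le> C * norm (x - y)"
proof -
  have "deriv h holomorphic_on UNIV" using assms by (intro holomorphic_deriv) auto
  then have "continuous_on (cball a r) (deriv h)"
    by (meson holomorphic_on_imp_continuous_on holomorphic_on_subset subset_UNIV)
  then have "bounded (deriv h ` cball a r)"
    by (intro compact_imp_bounded compact_continuous_image) auto
  then obtain C where C: "C > 0" "\<And>x. x \<in> cball a r \<Longrightarrow> norm (deriv h x) \<le> C"
    by (auto simp: bounded_pos)
  have "norm (h x - h y) \<le> C * norm (x - y)" if "x \<in> cball a r" "y \<in> cball a r" for x y
  proof (rule field_differentiable_bound[OF convex_cball _ C(2) that])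
    show "(h has_field_derivative deriv h z) (at z within cball a r)" for z
      using holomorphic_derivI[OF assms open_UNIV, of z] has_field_derivative_at_within by auto
  qed
  then show ?thesis using C(1) by (intro exI[of _ C]) auto
qed

text \<open>
  The deviation from the linear part is Lipschitz, with a constant proportional to the radius \<open>t\<close>. Along
  an orbit that leaves \<open>a\<close> geometrically, these constants form a geometric series.
\<close>

lemma entire_almost_linear:
  assumes F: "F holomorphic_on UNIV" and l: "(F has_field_derivative l) (at a)"
  shows "\<exists>C\<ge>0. \<forall>t\<le>1. \<forall>x\<in>cball a t. \<forall>y\<in>cball a t.
    norm (F x - F y - l * (x - y)) \<le> C * t * norm (x - y)"
proof -
  have "deriv F holomorphic_on UNIV" using F by (intro holomorphic_deriv) auto
  then obtain C where C: "C \<ge> 0"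
    "\<And>x y. x \<in> cball a 1 \<Longrightarrow> y \<in> cball a 1 \<Longrightarrow> norm (deriv F x - deriv F y) \<le> C * norm (x - y)"
    using entire_lipschitz_on_cball by metis
  have l': "deriv F a = l" using l by (rule DERIV_imp_deriv)
  have "norm (F x - F y - l * (x - y)) \<le> C * t * norm (x - y)"
    if t: "t \<le> 1" and xy: "x \<in> cball a t" "y \<in> cball a t" for t x y
  proof -
    have "norm ((F x - l * x) - (F y - l * y)) \<le> (C * t) * norm (x - y)"
    proof (rule field_differentiable_bound[OF convex_cball _ _ xy])
      show "((\<lambda>x. F x - l * x) has_field_derivative deriv F z - l) (at z within cball a t)" for z
      proof -
        have "(F has_field_derivative deriv F z) (at z within cball a t)"
          using holomorphic_derivI[OF F open_UNIV, of z] has_field_derivative_at_within by auto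
        then show ?thesis by (auto intro!: derivative_eq_intros)
      qed
      show "norm (deriv F z - l) \<le> C * t" if "z \<in> cball a t" for z
      proof -
        have "norm (deriv F z - deriv F a) \<le> C * norm (z - a)"
          using that t by (intro C) auto
        also have "\<dots> \<le> C * t"
          using that C(1) by (intro mult_left_mono) (auto simp: dist_norm norm_minus_commute)
        finally show ?thesis by (simp add: l')
      qed
    qed
    then show ?thesis by (simp add: algebra_simps)
  qed
  then show ?thesis using C(1) by blast
qed

lemma entire_isCont:
  assumes "h holomorphic_on UNIV"
  shows "isCont h z"
  using assms holomorphic_on_imp_differentiable_at field_differentiable_imp_continuous_at open_UNIV UNIV_I
  by metis

text \<open>
  The function is the limit of \<open>(F ^^ k) (a + w / l ^ k)\<close>. Two consecutive terms come from \<open>k\<close>-step orbits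
  whose starting points differ by a quantity of order \<open>1 / l ^ (2 * k)\<close>, so near \<open>0\<close> the terms differ by an
  amount of order \<open>1 / l ^ k\<close>. The functional equation extends the limit from a small disk to the plane.
\<close>

lemma poincare_function:
  fixes F :: "complex \<Rightarrow> complex"
  assumes F: "F holomorphic_on UNIV" and Fa: "F a = a"
    and l: "(F has_field_derivative l) (at a)" "norm l > 1"
  obtains \<phi> K \<delta> where "\<phi> holomorphic_on UNIV" "\<And>w. \<phi> (l * w) = F (\<phi> w)"
    "K \<ge> 0" "\<delta> > 0" "\<And>w. norm w \<le> \<delta> \<Longrightarrow> norm (\<phi> w - a - w) \<le> K * (norm w)\<^sup>2"
proof -
  define \<Lambda> where "\<Lambda> = norm l"
  have L: "\<Lambda> > 1" "\<Lambda> > 0" "\<Lambda> \<noteq> 0" using l(2) unfolding \<Lambda>_def by linarith+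
  have l0: "l \<noteq> 0" using l(2) by (intro notI) simp
  obtain C where C: "C \<ge> 0" "\<And>t x y. t \<le> 1 \<Longrightarrow> x \<in> cball a t \<Longrightarrow> y \<in> cball a t \<Longrightarrow>
      norm (F x - F y - l * (x - y)) \<le> C * t * norm (x - y)"
    using entire_almost_linear[OF F l(1)] by metis
  define E where "E = exp (C / (\<Lambda> - 1))"
  define \<delta> where "\<delta> = 1 / E"
  have E: "E > 0" and \<delta>: "\<delta> > 0" by (simp_all add: E_def \<delta>_def)
  have E1: "E \<ge> 1" using C(1) L by (simp add: E_def)
  have \<delta>1: "\<delta> \<le> 1" using E1 by (simp add: \<delta>_def)
  define x where "x k w j = (F ^^ j) (a + w / l ^ k)" for k w j
  define u where "u k w = x k w k" for k w
  have ratio: "\<Lambda> ^ j / \<Lambda> ^ k \<le> 1" if "j \<le> k" for j k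
    using L that by (simp add: power_increasing)
  have near: "x k w j \<in> cball a (\<Lambda> ^ j / \<Lambda> ^ k)" if w: "norm w \<le> \<delta>" and "j \<le> k" for k w j
  proof -
    have d0: "\<Lambda> ^ k * norm (x k w 0 - a) = norm w"
      using L by (simp add: x_def \<Lambda>_def norm_divide norm_power)
    have Ew: "E * norm w \<le> 1" using w E by (simp add: \<delta>_def field_simps)
    have "norm (x k w j - a) \<le> E * (\<Lambda> ^ k * norm (x k w 0 - a) + real k * 0) * (\<Lambda> ^ j / \<Lambda> ^ k)"
      unfolding E_def
    proof (rule discrete_gronwall[where M = 1 and b = 0 and d = "\<lambda>i. norm (x k w i - a)", OF L(1) C(1) _ _ _ _ \<open>j \<le> k\<close>])
      fix i assume i: "i < k" "norm (x k w i - a) \<le> 1 * (\<Lambda> ^ i / \<Lambda> ^ k)"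
      let ?t = "\<Lambda> ^ i / \<Lambda> ^ k"
      have "norm (F (x k w i) - F a - l * (x k w i - a)) \<le> C * ?t * norm (x k w i - a)"
      proof (rule C(2))
        show "?t \<le> 1" using i ratio[of i k] by simp
      qed (use i L in \<open>auto simp: dist_norm norm_minus_commute\<close>)
      then have "norm (F (x k w i) - F a) \<le> norm (l * (x k w i - a)) + C * ?t * norm (x k w i - a)"
        using norm_triangle_sub[of "F (x k w i) - F a" "l * (x k w i - a)"] by linarith
      then show "norm (x k w (Suc i) - a) \<le> (\<Lambda> + C * ?t) * norm (x k w i - a) + 0 * ?t"
        by (simp add: x_def Fa norm_mult \<Lambda>_def[symmetric] distrib_right)
    next
      show "exp (C / (\<Lambda> - 1)) * (\<Lambda> ^ k * norm (x k w 0 - a) + real k * 0) \<le> 1"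
        using Ew d0 unfolding E_def by simp
    qed auto
    also have "\<dots> = (E * norm w) * (\<Lambda> ^ j / \<Lambda> ^ k)" using d0 by simp
    also have "\<dots> \<le> 1 * (\<Lambda> ^ j / \<Lambda> ^ k)"
      using Ew L by (intro mult_right_mono) auto
    finally show ?thesis by (simp add: dist_norm norm_minus_commute)
  qed
  have diff: "norm (u (Suc k) w - u k w) \<le> E * C * (norm w)\<^sup>2 * (1 / \<Lambda>) ^ k"
    if w: "norm w \<le> \<delta>" for k w
  proof -
    \<comment> \<open>The longer orbit starts one step earlier, so it is compared after its first step.\<close>
    define d where "d j = norm (x (Suc k) w (Suc j) - x k w j)" for j
    have "d k \<le> E * (\<Lambda> ^ k * d 0 + real k * 0) * (\<Lambda> ^ k / \<Lambda> ^ k)"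
      unfolding E_def
    proof (rule discrete_gronwall[where M = "E * (\<Lambda> ^ k * d 0 + real k * 0)" and b = 0 and d = d, OF L(1) C(1)])
      fix i assume i: "i < k"
      let ?t = "\<Lambda> ^ i / \<Lambda> ^ k" and ?x = "x (Suc k) w (Suc i)" and ?y = "x k w i"
      have "norm (F ?x - F ?y - l * (?x - ?y)) \<le> C * ?t * norm (?x - ?y)"
      proof (rule C(2))
        show "?t \<le> 1" using i ratio[of i k] by simp
        show "?y \<in> cball a ?t" using near[OF w, of i k] i by simp
        show "?x \<in> cball a ?t" using near[OF w, of "Suc i" "Suc k"] i L by simp
      qed
      then have "norm (F ?x - F ?y) \<le> norm (l * (?x - ?y)) + C * ?t * norm (?x - ?y)"
        using norm_triangle_sub[of "F ?x - F ?y" "l * (?x - ?y)"] by linarith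
      then show "d (Suc i) \<le> (\<Lambda> + C * ?t) * d i + 0 * ?t"
        by (simp add: d_def x_def norm_mult \<Lambda>_def[symmetric] distrib_right)
    qed (simp_all add: d_def E_def)
    then have dk: "d k \<le> E * (\<Lambda> ^ k * d 0)" using L by simp
    define \<eta> where "\<eta> = w / l ^ Suc k"
    have norm_eta: "norm \<eta> = norm w / \<Lambda> ^ Suc k" by (simp add: \<eta>_def \<Lambda>_def norm_divide norm_power norm_mult)
    have "norm \<eta> \<le> norm w"
      unfolding norm_eta using one_le_power[of \<Lambda> "Suc k"] L
      by (simp add: divide_le_eq mult_le_cancel_left1 del: power_Suc)
    then have eta1: "norm \<eta> \<le> 1" using w \<delta>1 by linarith
    have "d 0 = norm (F (a + \<eta>) - F a - l * ((a + \<eta>) - a))"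
      using l0 by (simp add: d_def x_def Fa \<eta>_def field_simps)
    also have "\<dots> \<le> C * norm \<eta> * norm ((a + \<eta>) - a)"
      by (rule C(2)[OF eta1]) (auto simp: dist_norm)
    also have "\<dots> = C * (norm w)\<^sup>2 / (\<Lambda> ^ Suc k * \<Lambda> ^ Suc k)"
      by (simp add: norm_eta power2_eq_square)
    also have "\<dots> \<le> C * (norm w)\<^sup>2 / (\<Lambda> ^ k * \<Lambda> ^ k)"
      using L C(1) by (intro divide_left_mono mult_mono power_increasing) auto
    finally have "d 0 \<le> C * (norm w)\<^sup>2 / (\<Lambda> ^ k * \<Lambda> ^ k)" .
    then have "\<Lambda> ^ k * d 0 \<le> \<Lambda> ^ k * (C * (norm w)\<^sup>2 / (\<Lambda> ^ k * \<Lambda> ^ k))"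
      using L by (intro mult_left_mono) auto
    also have "\<dots> = C * (norm w)\<^sup>2 * (1 / \<Lambda>) ^ k" using L by (simp add: field_simps)
    finally have "\<Lambda> ^ k * d 0 \<le> C * (norm w)\<^sup>2 * (1 / \<Lambda>) ^ k" .
    then have "E * (\<Lambda> ^ k * d 0) \<le> E * (C * (norm w)\<^sup>2 * (1 / \<Lambda>) ^ k)"
      using E by (intro mult_left_mono) auto
    then show ?thesis using dk by (simp add: d_def u_def mult.assoc)
  qed
  define \<psi> where "\<psi> w = a + w + (\<Sum>k. u (Suc k) w - u k w)" for w
  have summ: "summable (\<lambda>k. (1 / \<Lambda>) ^ k)" using L by (intro summable_geometric) auto
  have partial: "u n w = a + w + (\<Sum>k<n. u (Suc k) w - u k w)" for n w
    by (subst sum_lessThan_telescope) (simp add: u_def x_def)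
  have unif: "uniform_limit (cball 0 \<delta>) u \<psi> sequentially"
  proof -
    have "uniform_limit (cball 0 \<delta>) (\<lambda>n w. \<Sum>k<n. u (Suc k) w - u k w)
        (\<lambda>w. \<Sum>k. u (Suc k) w - u k w) sequentially"
    proof (rule Weierstrass_m_test)
      show "norm (u (Suc n) w - u n w) \<le> E * C * (1 / \<Lambda>) ^ n" if "w \<in> cball 0 \<delta>" for n w
      proof -
        have "(norm w)\<^sup>2 \<le> 1" using that \<delta>1 by (simp add: power_le_one)
        then have "E * C * (norm w)\<^sup>2 * (1 / \<Lambda>) ^ n \<le> E * C * 1 * (1 / \<Lambda>) ^ n"
          using E C(1) L by (intro mult_right_mono mult_left_mono) auto
        then show ?thesis using diff[of w n] that by simp
      qed
      show "summable (\<lambda>n. E * C * (1 / \<Lambda>) ^ n)" using summ by (rule summable_mult)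
    qed
    then have "uniform_limit (cball 0 \<delta>) (\<lambda>n w. a + w + (\<Sum>k<n. u (Suc k) w - u k w)) \<psi> sequentially"
      unfolding \<psi>_def by (intro uniform_limit_intros)
    moreover have "(\<lambda>n w. a + w + (\<Sum>k<n. u (Suc k) w - u k w)) = u"
      by (intro ext) (rule partial[symmetric])
    ultimately show ?thesis by simp
  qed
  have hol_iter: "(F ^^ n) holomorphic_on UNIV" for n
  proof (induction n)
    case (Suc n)
    have "F \<circ> F ^^ n holomorphic_on UNIV"
      by (rule holomorphic_on_compose_gen[OF Suc F]) simp
    then show ?case by (simp only: funpow.simps)
  qed (simp add: id_def)
  have hol_u: "u n holomorphic_on UNIV" for n
  proof -
    have "(F ^^ n) \<circ> (\<lambda>w. a + w / l ^ n) holomorphic_on UNIV"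
      using l0 by (intro holomorphic_on_compose_gen[OF _ hol_iter]) (auto intro!: holomorphic_intros)
    then show ?thesis by (simp add: u_def[abs_def] x_def comp_def)
  qed
  have hol_psi: "\<psi> holomorphic_on ball 0 \<delta>"
  proof (rule holomorphic_uniform_sequence[of "ball 0 \<delta>" u \<psi>])
    show "u n holomorphic_on ball 0 \<delta>" for n using hol_u by (rule holomorphic_on_subset) auto
    fix w :: complex assume "w \<in> ball 0 \<delta>"
    then obtain d where "d > 0" "cball w d \<subseteq> ball 0 \<delta>"
      using open_contains_cball[of "ball 0 \<delta>"] by blast
    moreover from this have "cball w d \<subseteq> cball 0 \<delta>" using ball_subset_cball by blast
    ultimately show "\<exists>d>0. cball w d \<subseteq> ball 0 \<delta> \<and> uniform_limit (cball w d) u \<psi> sequentially"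
      using uniform_limit_on_subset[OF unif] by blast
  qed auto
  have psi_lim: "(\<lambda>n. u n w) \<longlonglongrightarrow> \<psi> w" if "norm w \<le> \<delta>" for w
    using tendsto_uniform_limitI[OF unif, of w] that by simp
  define \<phi> where "\<phi> w = lim (\<lambda>n. u n w)" for w
  have lim: "(\<lambda>n. u n w) \<longlonglongrightarrow> (F ^^ m) (\<psi> (w / l ^ m))" if "norm w < \<delta> * \<Lambda> ^ m" for m w
  proof -
    have "norm (w / l ^ m) \<le> \<delta>"
      using that L by (simp add: norm_divide norm_power \<Lambda>_def[symmetric] field_simps)
    then have "(\<lambda>n. u n (w / l ^ m)) \<longlonglongrightarrow> \<psi> (w / l ^ m)" by (rule psi_lim)
    then have "(\<lambda>n. (F ^^ m) (u n (w / l ^ m))) \<longlonglongrightarrow> (F ^^ m) (\<psi> (w / l ^ m))"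
      by (rule isCont_tendsto_compose[OF entire_isCont[OF hol_iter]])
    moreover have "(F ^^ m) (u n (w / l ^ m)) = u (n + m) w" for n
    proof -
      have "w / l ^ m / l ^ n = w / l ^ (n + m)" by (simp add: power_add mult.commute)
      moreover have "(F ^^ m) ((F ^^ n) v) = (F ^^ (n + m)) v" for v
        by (subst add.commute) (simp add: funpow_add)
      ultimately show ?thesis unfolding u_def x_def by metis
    qed
    ultimately have "(\<lambda>n. u (n + m) w) \<longlonglongrightarrow> (F ^^ m) (\<psi> (w / l ^ m))" by simp
    then show ?thesis by (rule LIMSEQ_offset)
  qed
  have phi_eq: "\<phi> w = (F ^^ m) (\<psi> (w / l ^ m))" if "norm w < \<delta> * \<Lambda> ^ m" for m w
    using lim[OF that] unfolding \<phi>_def by (rule limI)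
  have exm: "\<exists>m. norm w < \<delta> * \<Lambda> ^ m" for w :: complex
  proof -
    obtain m where "norm w / \<delta> < \<Lambda> ^ m" using real_arch_pow[OF L(1)] by blast
    then show ?thesis using \<delta> by (intro exI[of _ m]) (simp add: field_simps)
  qed
  have phi_lim: "(\<lambda>n. u n w) \<longlonglongrightarrow> \<phi> w" for w
    using exm[of w] lim phi_eq by force
  have "\<phi> holomorphic_on ball 0 (\<delta> * \<Lambda> ^ m)" for m
  proof -
    have "(F ^^ m) \<circ> (\<psi> \<circ> (\<lambda>w. w / l ^ m)) holomorphic_on ball 0 (\<delta> * \<Lambda> ^ m)"
    proof (intro holomorphic_on_compose_gen[OF _ hol_iter] holomorphic_on_compose_gen[OF _ hol_psi])
      show "(\<lambda>w. w / l ^ m) ` ball 0 (\<delta> * \<Lambda> ^ m) \<subseteq> ball 0 \<delta>"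
        using L by (auto simp: norm_divide norm_power \<Lambda>_def[symmetric] field_simps)
    qed (use l0 in \<open>auto intro!: holomorphic_intros\<close>)
    then show ?thesis
      by (rule holomorphic_transform) (auto simp: phi_eq[of _ m])
  qed
  then have "\<phi> holomorphic_on (\<Union>m. ball 0 (\<delta> * \<Lambda> ^ m))"
    by (intro holomorphic_on_UN_open) auto
  moreover have "(\<Union>m. ball 0 (\<delta> * \<Lambda> ^ m)) = (UNIV :: complex set)"
    using exm by auto
  ultimately have hol: "\<phi> holomorphic_on UNIV" by simp
  have feq: "\<phi> (l * w) = F (\<phi> w)" for w
  proof -
    have "isCont F (\<phi> w)"
      by (rule entire_isCont[OF F])
    then have "(\<lambda>n. F (u n w)) \<longlonglongrightarrow> F (\<phi> w)"
      using phi_lim by (rule isCont_tendsto_compose)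
    moreover have "F (u n w) = u (Suc n) (l * w)" for n
      using l0 by (simp add: u_def x_def)
    moreover have "(\<lambda>n. u (Suc n) (l * w)) \<longlonglongrightarrow> \<phi> (l * w)"
      using phi_lim by (rule LIMSEQ_Suc)
    ultimately show ?thesis using LIMSEQ_unique by simp
  qed
  define K where "K = E * C * (\<Sum>k. (1 / \<Lambda>) ^ k)"
  have K: "K \<ge> 0" using E C(1) L summ by (simp add: K_def suminf_nonneg)
  have "norm (\<phi> w - a - w) \<le> K * (norm w)\<^sup>2" if w: "norm w \<le> \<delta>" for w
  proof (rule LIMSEQ_le_const2)
    show "(\<lambda>n. norm (u n w - a - w)) \<longlonglongrightarrow> norm (\<phi> w - a - w)"
      by (intro tendsto_intros phi_lim)
    have "norm (u n w - a - w) \<le> K * (norm w)\<^sup>2" for n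
    proof -
      have "norm (u n w - a - w) \<le> (\<Sum>k<n. norm (u (Suc k) w - u k w))"
        by (subst partial) (simp add: sum_norm_le)
      also have "\<dots> \<le> (\<Sum>k<n. E * C * (norm w)\<^sup>2 * (1 / \<Lambda>) ^ k)"
        by (intro sum_mono diff w)
      also have "\<dots> = E * C * (norm w)\<^sup>2 * (\<Sum>k<n. (1 / \<Lambda>) ^ k)"
        by (simp add: sum_distrib_left)
      also have "\<dots> \<le> E * C * (norm w)\<^sup>2 * (\<Sum>k. (1 / \<Lambda>) ^ k)"
        using E C(1) L by (intro mult_left_mono sum_le_suminf summ) auto
      finally show ?thesis by (simp add: K_def mult_ac)
    qed
    then show "\<exists>N. \<forall>n\<ge>N. norm (u n w - a - w) \<le> K * (norm w)\<^sup>2" by blast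
  qed
  then show thesis using that hol feq K \<delta> by blast
qed

lemma holomorphic_on_quad_deriv: "quad_deriv c n holomorphic_on S"
  "quad_param_deriv c n holomorphic_on S"
proof -
  have "(\<lambda>z. quad_deriv c n z) holomorphic_on S \<and> (\<lambda>z. quad_param_deriv c n z) holomorphic_on S"
    by (induction n) (auto intro!: holomorphic_intros)
  then show "quad_deriv c n holomorphic_on S" "quad_param_deriv c n holomorphic_on S" by auto
qed

lemma entire_bounded_on_cball:
  assumes "h holomorphic_on UNIV"
  shows "\<exists>D\<ge>0. \<forall>x. norm x \<le> R \<longrightarrow> norm (h x :: complex) \<le> D"
proof -
  have "bounded (h ` cball 0 R)"
    using assms by (intro compact_imp_bounded compact_continuous_image)
      (auto intro: holomorphic_on_imp_continuous_on holomorphic_on_subset)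
  then show ?thesis by (auto simp: bounded_pos intro: less_imp_le)
qed

text \<open>
  Differentiability in the point and the parameter jointly, with an error that is quadratic uniformly
  on a disk.
\<close>

lemma quad_iter_expansion:
  "\<exists>C\<ge>0. \<forall>x \<epsilon> \<delta>. norm x \<le> R \<longrightarrow> norm \<epsilon> \<le> 1 \<longrightarrow> norm \<delta> \<le> 1 \<longrightarrow>
    norm ((quad (c + \<epsilon>) ^^ n) (x + \<delta>) - (quad c ^^ n) x
      - quad_deriv c n x * \<delta> - quad_param_deriv c n x * \<epsilon>) \<le> C * (norm \<epsilon> + norm \<delta>)\<^sup>2"
proof (induction n)
  case (Suc n)
  then obtain C where C: "C \<ge> 0" and exp: "\<And>x \<epsilon> \<delta>. norm x \<le> R \<Longrightarrow> norm \<epsilon> \<le> 1 \<Longrightarrow> norm \<delta> \<le> 1 \<Longrightarrow>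
    norm ((quad (c + \<epsilon>) ^^ n) (x + \<delta>) - (quad c ^^ n) x
      - quad_deriv c n x * \<delta> - quad_param_deriv c n x * \<epsilon>) \<le> C * (norm \<epsilon> + norm \<delta>)\<^sup>2"
    by blast
  have "(quad c ^^ n) holomorphic_on UNIV"
    using holomorphic_on_quad_iter[of "\<lambda>_. c" UNIV "\<lambda>z. z" n] by simp
  then obtain D1 where D1: "D1 \<ge> 0" "\<And>x. norm x \<le> R \<Longrightarrow> norm ((quad c ^^ n) x) \<le> D1"
    using entire_bounded_on_cball by metis
  obtain D2 where D2: "D2 \<ge> 0" "\<And>x. norm x \<le> R \<Longrightarrow> norm (quad_deriv c n x) \<le> D2"
    using entire_bounded_on_cball[OF holomorphic_on_quad_deriv(1)] by metis
  obtain D3 where D3: "D3 \<ge> 0" "\<And>x. norm x \<le> R \<Longrightarrow> norm (quad_param_deriv c n x) \<le> D3"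
    using entire_bounded_on_cball[OF holomorphic_on_quad_deriv(2)] by metis
  define M where "M = D2 + D3 + 2 * C"
  have "norm ((quad (c + \<epsilon>) ^^ Suc n) (x + \<delta>) - (quad c ^^ Suc n) x
      - quad_deriv c (Suc n) x * \<delta> - quad_param_deriv c (Suc n) x * \<epsilon>)
      \<le> (2 * D1 * C + M\<^sup>2) * (norm \<epsilon> + norm \<delta>)\<^sup>2"
    if x: "norm x \<le> R" and small: "norm \<epsilon> \<le> 1" "norm \<delta> \<le> 1" for x \<epsilon> \<delta>
  proof -
    define h where "h = norm \<epsilon> + norm \<delta>"
    have h: "0 \<le> h" "h \<le> 2" using small by (simp_all add: h_def)
    define e where "e = (quad (c + \<epsilon>) ^^ n) (x + \<delta>) - (quad c ^^ n) x"
    define \<rho> where "\<rho> = e - quad_deriv c n x * \<delta> - quad_param_deriv c n x * \<epsilon>"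
    have \<rho>: "norm \<rho> \<le> C * h\<^sup>2" using exp[OF x small] by (simp add: \<rho>_def e_def h_def)
    have "h\<^sup>2 \<le> 2 * h" using mult_right_mono[OF h(2) h(1)] by (simp add: power2_eq_square)
    then have "C * h\<^sup>2 \<le> C * (2 * h)" using C by (rule mult_left_mono)
    moreover have "norm (quad_deriv c n x * \<delta>) \<le> D2 * h"
      unfolding norm_mult using D2 x by (intro mult_mono) (auto simp: h_def)
    moreover have "norm (quad_param_deriv c n x * \<epsilon>) \<le> D3 * h"
      unfolding norm_mult using D3 x by (intro mult_mono) (auto simp: h_def)
    moreover have "norm e \<le> norm \<rho> + norm (quad_deriv c n x * \<delta>) + norm (quad_param_deriv c n x * \<epsilon>)"
    proof -
      have "e = \<rho> + quad_deriv c n x * \<delta> + quad_param_deriv c n x * \<epsilon>" by (simp add: \<rho>_def)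
      then show ?thesis by (metis norm_triangle_mono norm_triangle_ineq order_refl)
    qed
    ultimately have "norm e \<le> M * h" using \<rho> unfolding M_def by (simp add: algebra_simps)
    then have "(norm e)\<^sup>2 \<le> (M * h)\<^sup>2" by (intro power_mono) auto
    then have e2: "norm (e\<^sup>2) \<le> M\<^sup>2 * h\<^sup>2" by (simp add: norm_power power_mult_distrib)
    have "norm (2 * (quad c ^^ n) x * \<rho>) \<le> 2 * D1 * (C * h\<^sup>2)"
      unfolding norm_mult using \<rho> D1 x by (intro mult_mono) auto
    moreover have "(quad (c + \<epsilon>) ^^ Suc n) (x + \<delta>) - (quad c ^^ Suc n) x
        - quad_deriv c (Suc n) x * \<delta> - quad_param_deriv c (Suc n) x * \<epsilon>
        = 2 * (quad c ^^ n) x * \<rho> + e\<^sup>2"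
      unfolding quad_iter_Suc \<rho>_def e_def by (simp add: power2_eq_square algebra_simps)
    ultimately show ?thesis
      using e2 norm_triangle_ineq[of "2 * (quad c ^^ n) x * \<rho>" "e\<^sup>2"]
      unfolding h_def[symmetric] by (simp add: algebra_simps)
  qed
  moreover have "2 * D1 * C + M\<^sup>2 \<ge> 0" using D1 C by simp
  ultimately show ?case by blast
qed (auto intro: exI[of _ 0])

text \<open>
  The point \<open>V k w\<close> lies close to \<open>a + \<alpha> * \<epsilon> + w / l ^ k\<close>, where \<open>\<epsilon>\<close> is the change of the parameter and
  \<open>\<alpha>\<close> is the speed at which the repelling periodic point moves with the parameter; \<open>\<alpha>\<close> is determined
  by differentiating the equation of the periodic point. The orbit of \<open>V k w\<close> is compared with the orbit
  \<open>\<phi> (w * l ^ j / l ^ k)\<close> of the unperturbed map, shifted by \<open>\<alpha> * \<epsilon>\<close>. With this shift the terms linear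
  in \<open>\<epsilon>\<close> cancel at \<open>a\<close>, and Gronwall's inequality bounds what remains.
\<close>

lemma shadowing:
  fixes c a l \<alpha> :: complex and \<phi> :: "complex \<Rightarrow> complex" and C V :: "nat \<Rightarrow> complex \<Rightarrow> complex"
  assumes l: "l = quad_deriv c p a" "norm l > 1"
    and \<alpha>: "l * \<alpha> + quad_param_deriv c p a = \<alpha>"
    and \<phi>: "\<phi> holomorphic_on UNIV" "\<And>w. \<phi> (l * w) = (quad c ^^ p) (\<phi> w)"
    and taylor: "K \<ge> 0" "\<delta> > 0" "\<And>w. norm w \<le> \<delta> \<Longrightarrow> norm (\<phi> w - a - w) \<le> K * (norm w)\<^sup>2"
    and B: "B \<ge> 0"
    and C: "\<And>k w. norm w \<le> R \<Longrightarrow> norm (C k w - c) \<le> B / norm l ^ k"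
    and V: "\<And>k w. k \<ge> k1 \<Longrightarrow> norm w \<le> R \<Longrightarrow>
      norm (V k w - a - \<alpha> * (C k w - c) - w / l ^ k) \<le> B / (norm l ^ k * norm l ^ k)"
    and R: "R \<ge> 0"
  shows "uniform_limit (cball 0 R) (\<lambda>k w. (quad (C k w) ^^ (p * k)) (V k w)) \<phi> sequentially"
proof -
  define \<Lambda> where "\<Lambda> = norm l"
  have L: "\<Lambda> > 1" "\<Lambda> > 0" using l(2) unfolding \<Lambda>_def by linarith+
  have l0: "l \<noteq> 0" using l(2) by (intro notI) simp
  have phi0: "\<phi> 0 = a" using taylor(3)[of 0] taylor(2) by simp
  obtain L1 where L1: "L1 \<ge> 0" "\<And>x. norm x \<le> R \<Longrightarrow> norm (\<phi> x - a) \<le> L1 * norm x"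
  proof -
    obtain L1 where "L1 \<ge> 0" "\<forall>x\<in>cball 0 R. \<forall>y\<in>cball 0 R. norm (\<phi> x - \<phi> y) \<le> L1 * norm (x - y)"
      using entire_lipschitz_on_cball[OF \<phi>(1)] by blast
    then show ?thesis using that[of L1] R phi0 by (metis diff_zero dist_0_norm mem_cball norm_zero)
  qed
  obtain X where X: "\<And>x. norm x \<le> R \<Longrightarrow> norm (\<phi> x) \<le> X"
    using entire_bounded_on_cball[OF \<phi>(1)] by blast
  have aX: "norm a \<le> X" using X[of 0] R phi0 by simp
  obtain Ld1 where Ld1: "Ld1 \<ge> 0" "\<And>x. norm x \<le> X \<Longrightarrow> norm (quad_deriv c p x - l) \<le> Ld1 * norm (x - a)"
    using entire_lipschitz_on_cball[OF holomorphic_on_quad_deriv(1)[where c = c and n = p], where a = 0 and r = X] aX l(1) by auto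
  obtain Ld2 where Ld2: "Ld2 \<ge> 0"
    "\<And>x. norm x \<le> X \<Longrightarrow> norm (quad_param_deriv c p x - quad_param_deriv c p a) \<le> Ld2 * norm (x - a)"
    using entire_lipschitz_on_cball[OF holomorphic_on_quad_deriv(2)[where c = c and n = p], where a = 0 and r = X] aX by auto
  define Ld where "Ld = (Ld1 + Ld2) * (L1 * R)"
  have Ld: "Ld \<ge> 0" using Ld1 Ld2 L1 R by (simp add: Ld_def)
  obtain Q where Q: "Q \<ge> 0" "\<And>x \<epsilon> \<delta>. norm x \<le> X \<Longrightarrow> norm \<epsilon> \<le> 1 \<Longrightarrow> norm \<delta> \<le> 1 \<Longrightarrow>
    norm ((quad (c + \<epsilon>) ^^ p) (x + \<delta>) - (quad c ^^ p) x
      - quad_deriv c p x * \<delta> - quad_param_deriv c p x * \<epsilon>) \<le> Q * (norm \<epsilon> + norm \<delta>)\<^sup>2"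
    using quad_iter_expansion[where R = X and c = c and n = p] by blast
  define A where "A = Ld + 2 * Q"
  have A: "A \<ge> 0" using Ld Q by (simp add: A_def)
  define b where "b = (Ld * (1 + norm \<alpha>) + 2 * Q * (1 + norm \<alpha>)\<^sup>2 * B) * B"
  have b: "b \<ge> 0" using Ld Q B by (simp add: b_def)
  define E where "E = exp (A / (\<Lambda> - 1))"
  define T where "T k = E * ((B + K * R\<^sup>2) / \<Lambda> ^ k + real k * (b / \<Lambda> ^ k))" for k
  have inv0: "(\<lambda>k. s / \<Lambda> ^ k) \<longlonglongrightarrow> 0" for s
    using L tendsto_mult[OF tendsto_const[of s] LIMSEQ_inverse_realpow_zero[OF L(1)]]
    by (simp add: divide_inverse)
  have "(\<lambda>k. real k * (1 / \<Lambda>) ^ k) \<longlonglongrightarrow> 0"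
    using L by (intro powser_times_n_limit_0[of "1 / \<Lambda>", simplified]) auto
  then have "(\<lambda>k. b * (real k * (1 / \<Lambda>) ^ k)) \<longlonglongrightarrow> 0" by (rule tendsto_mult_right_zero)
  then have "(\<lambda>k. real k * (b / \<Lambda> ^ k)) \<longlonglongrightarrow> 0" by (simp add: power_one_over field_simps)
  then have T0: "T \<longlonglongrightarrow> 0"
    unfolding T_def using inv0[of "B + K * R\<^sup>2"] tendsto_add_zero tendsto_mult_right_zero by blast
  have key: "norm ((quad (C k w) ^^ (p * k)) (V k w) - \<phi> w) \<le> T k + norm \<alpha> * B / \<Lambda> ^ k"
    if k: "k \<ge> k1" "T k \<le> 1 / 2" "norm \<alpha> * B / \<Lambda> ^ k \<le> 1 / 2" "B / \<Lambda> ^ k \<le> 1" "R / \<Lambda> ^ k \<le> \<delta>"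
      and w: "norm w \<le> R" for k w
  proof -
    define \<epsilon> where "\<epsilon> = C k w - c"
    have \<epsilon>: "norm \<epsilon> \<le> B / \<Lambda> ^ k" using C[OF w] by (simp add: \<epsilon>_def \<Lambda>_def)
    have \<epsilon>1: "norm \<epsilon> \<le> 1" using \<epsilon> k by linarith
    have \<alpha>\<epsilon>: "norm (\<alpha> * \<epsilon>) \<le> norm \<alpha> * B / \<Lambda> ^ k"
      using mult_left_mono[OF \<epsilon>, of "norm \<alpha>"] by (simp add: norm_mult)
    define x where "x j = \<phi> (w * l ^ j / l ^ k)" for j
    define y where "y j = (quad (c + \<epsilon>) ^^ (p * j)) (V k w)" for j
    define d where "d j = y j - x j - \<alpha> * \<epsilon>" for j
    have xSuc: "x (Suc j) = (quad c ^^ p) (x j)" for j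
      using \<phi>(2)[of "w * l ^ j / l ^ k"] by (simp add: x_def mult_ac)
    have ySuc: "y (Suc j) = (quad (c + \<epsilon>) ^^ p) (y j)" for j
      by (simp add: y_def quad_iter_add)
    have arg: "norm (w * l ^ j / l ^ k) = norm w * (\<Lambda> ^ j / \<Lambda> ^ k)" for j
      by (simp add: norm_mult norm_divide norm_power \<Lambda>_def)
    have d0: "\<Lambda> ^ k * norm (d 0) \<le> (B + K * R\<^sup>2) / \<Lambda> ^ k"
    proof -
      have nw: "norm (w / l ^ k) = norm w / \<Lambda> ^ k" by (simp add: norm_divide norm_power \<Lambda>_def)
      have le: "norm w / \<Lambda> ^ k \<le> R / \<Lambda> ^ k" using w L by (intro divide_right_mono) auto
      have "norm (\<phi> (w / l ^ k) - a - w / l ^ k) \<le> K * (norm w / \<Lambda> ^ k)\<^sup>2"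
        using taylor(3)[of "w / l ^ k"] nw le k(5) by simp
      also have "\<dots> \<le> K * (R / \<Lambda> ^ k)\<^sup>2"
        using le L taylor(1) by (intro mult_left_mono power_mono) auto
      finally have 1: "norm (\<phi> (w / l ^ k) - a - w / l ^ k) \<le> K * R\<^sup>2 / (\<Lambda> ^ k * \<Lambda> ^ k)"
        by (simp add: power2_eq_square)
      have 2: "norm (V k w - a - \<alpha> * \<epsilon> - w / l ^ k) \<le> B / (\<Lambda> ^ k * \<Lambda> ^ k)"
        using V[OF k(1) w] by (simp add: \<epsilon>_def \<Lambda>_def)
      have "d 0 = (V k w - a - \<alpha> * \<epsilon> - w / l ^ k) - (\<phi> (w / l ^ k) - a - w / l ^ k)"
        by (simp add: d_def x_def y_def)
      then have "norm (d 0) \<le> norm (V k w - a - \<alpha> * \<epsilon> - w / l ^ k) + norm (\<phi> (w / l ^ k) - a - w / l ^ k)"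
        by (simp only: norm_triangle_ineq4)
      then have "norm (d 0) \<le> (B + K * R\<^sup>2) / (\<Lambda> ^ k * \<Lambda> ^ k)"
        using 1 2 unfolding add_divide_distrib by linarith
      then have "\<Lambda> ^ k * norm (d 0) \<le> \<Lambda> ^ k * ((B + K * R\<^sup>2) / (\<Lambda> ^ k * \<Lambda> ^ k))"
        using L by (intro mult_left_mono) auto
      then show ?thesis using L by simp
    qed
    have Tk: "E * (\<Lambda> ^ k * norm (d 0) + real k * (b / \<Lambda> ^ k)) \<le> T k"
      unfolding T_def using d0 by (intro mult_left_mono add_right_mono) (auto simp: E_def)
    have "norm (d k) \<le> E * (\<Lambda> ^ k * norm (d 0) + real k * (b / \<Lambda> ^ k)) * (\<Lambda> ^ k / \<Lambda> ^ k)"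
      unfolding E_def
    proof (rule discrete_gronwall[where M = "1 / 2" and d = "\<lambda>j. norm (d j)", OF L(1) A])
      fix j assume j: "j < k" and small: "norm (d j) \<le> 1 / 2 * (\<Lambda> ^ j / \<Lambda> ^ k)"
      define \<tau> where "\<tau> = \<Lambda> ^ j / \<Lambda> ^ k"
      have \<tau>: "\<tau> > 0" "\<tau> \<le> 1" using L j by (auto simp: \<tau>_def power_increasing)
      have inv_le: "1 / \<Lambda> ^ k \<le> \<tau>" using L by (simp add: \<tau>_def divide_right_mono)
      have warg: "norm (w * l ^ j / l ^ k) \<le> R * \<tau>"
        unfolding arg \<tau>_def[symmetric] using w \<tau> by (intro mult_right_mono) auto
      also have "R * \<tau> \<le> R" using R \<tau> by (simp add: mult_left_le)
      finally have wR: "norm (w * l ^ j / l ^ k) \<le> R" .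
      have xX: "norm (x j) \<le> X" using X[OF wR] by (simp add: x_def)
      have "norm (x j - a) \<le> L1 * norm (w * l ^ j / l ^ k)"
        using L1(2)[OF wR] by (simp add: x_def)
      also have "\<dots> \<le> L1 * (R * \<tau>)" using warg L1(1) by (rule mult_left_mono)
      finally have xa: "norm (x j - a) \<le> L1 * R * \<tau>" by (simp add: mult.assoc)
      have dz: "norm (quad_deriv c p (x j) - l) \<le> Ld * \<tau>"
      proof -
        have "norm (quad_deriv c p (x j) - l) \<le> Ld1 * norm (x j - a)" by (rule Ld1(2)[OF xX])
        also have "\<dots> \<le> (Ld1 + Ld2) * (L1 * R * \<tau>)"
          using xa Ld1(1) Ld2(1) L1(1) R \<tau> by (intro mult_mono) auto
        finally show ?thesis by (simp add: Ld_def mult.assoc)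
      qed
      have dc: "norm (quad_param_deriv c p (x j) - quad_param_deriv c p a) \<le> Ld * \<tau>"
      proof -
        have "norm (quad_param_deriv c p (x j) - quad_param_deriv c p a) \<le> Ld2 * norm (x j - a)"
          by (rule Ld2(2)[OF xX])
        also have "\<dots> \<le> (Ld1 + Ld2) * (L1 * R * \<tau>)"
          using xa Ld1(1) Ld2(1) L1(1) R \<tau> by (intro mult_mono) auto
        finally show ?thesis by (simp add: Ld_def mult.assoc)
      qed
      define \<eta> where "\<eta> = \<alpha> * \<epsilon> + d j"
      have dj: "norm (d j) \<le> 1 / 2 * \<tau>" using small by (simp add: \<tau>_def)
      have eta1: "norm \<eta> \<le> 1"
        using norm_triangle_ineq[of "\<alpha> * \<epsilon>" "d j"] \<alpha>\<epsilon> k(3) dj \<tau> unfolding \<eta>_def by linarith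
      define \<rho> where "\<rho> = (quad (c + \<epsilon>) ^^ p) (x j + \<eta>) - (quad c ^^ p) (x j)
        - quad_deriv c p (x j) * \<eta> - quad_param_deriv c p (x j) * \<epsilon>"
      have "norm \<rho> \<le> Q * (norm \<epsilon> + norm \<eta>)\<^sup>2"
        unfolding \<rho>_def by (rule Q(2)[OF xX \<epsilon>1 eta1])
      also have "\<dots> \<le> Q * (2 * ((1 + norm \<alpha>)\<^sup>2 * (norm \<epsilon>)\<^sup>2) + 2 * (norm (d j))\<^sup>2)"
      proof (intro mult_left_mono Q(1))
        have "norm \<epsilon> + norm \<eta> \<le> (1 + norm \<alpha>) * norm \<epsilon> + norm (d j)"
          using norm_triangle_ineq[of "\<alpha> * \<epsilon>" "d j"] by (simp add: \<eta>_def norm_mult algebra_simps)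
        then have "(norm \<epsilon> + norm \<eta>)\<^sup>2 \<le> ((1 + norm \<alpha>) * norm \<epsilon> + norm (d j))\<^sup>2"
          by (intro power_mono) auto
        also have "\<dots> \<le> 2 * ((1 + norm \<alpha>) * norm \<epsilon>)\<^sup>2 + 2 * (norm (d j))\<^sup>2"
          using zero_le_power2[of "(1 + norm \<alpha>) * norm \<epsilon> - norm (d j)"]
          by (simp add: power2_sum power2_diff)
        finally show "(norm \<epsilon> + norm \<eta>)\<^sup>2 \<le> 2 * ((1 + norm \<alpha>)\<^sup>2 * (norm \<epsilon>)\<^sup>2) + 2 * (norm (d j))\<^sup>2"
          by (simp add: power_mult_distrib)
      qed
      also have "\<dots> \<le> Q * (2 * ((1 + norm \<alpha>)\<^sup>2 * (B * B / \<Lambda> ^ k * \<tau>)) + 2 * (\<tau> * norm (d j)))"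
      proof (intro mult_left_mono Q(1) add_mono)
        have "(norm \<epsilon>)\<^sup>2 \<le> (B / \<Lambda> ^ k) * (B / \<Lambda> ^ k)"
          unfolding power2_eq_square using \<epsilon> B L by (intro mult_mono) auto
        also have "\<dots> = B * B / \<Lambda> ^ k * (1 / \<Lambda> ^ k)" by simp
        also have "\<dots> \<le> B * B / \<Lambda> ^ k * \<tau>"
          using inv_le B L by (intro mult_left_mono) auto
        finally show "(norm \<epsilon>)\<^sup>2 \<le> B * B / \<Lambda> ^ k * \<tau>" .
        have "norm (d j) * norm (d j) \<le> \<tau> * norm (d j)"
          using dj \<tau> by (intro mult_right_mono) auto
        then show "(norm (d j))\<^sup>2 \<le> \<tau> * norm (d j)" by (simp add: power2_eq_square)
      qed auto
      finally have \<rho>: "norm \<rho> \<le> 2 * Q * (1 + norm \<alpha>)\<^sup>2 * B * B / \<Lambda> ^ k * \<tau> + 2 * Q * \<tau> * norm (d j)"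
        by (simp add: algebra_simps)
      let ?m = "(quad_deriv c p (x j) - l) * \<alpha> + (quad_param_deriv c p (x j) - quad_param_deriv c p a)"
      have "norm ?m \<le> norm ((quad_deriv c p (x j) - l) * \<alpha>)
          + norm (quad_param_deriv c p (x j) - quad_param_deriv c p a)"
        by (rule norm_triangle_ineq)
      also have "\<dots> \<le> Ld * \<tau> * norm \<alpha> + Ld * \<tau>"
        using dz dc by (intro add_mono) (auto simp: norm_mult intro: mult_right_mono)
      finally have "norm ?m \<le> Ld * (1 + norm \<alpha>) * \<tau>" by (simp add: algebra_simps)
      then have "norm (?m * \<epsilon>) \<le> Ld * (1 + norm \<alpha>) * \<tau> * (B / \<Lambda> ^ k)"
        unfolding norm_mult using \<epsilon> Ld \<tau> by (intro mult_mono) auto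
      then have mid: "norm (?m * \<epsilon>) \<le> Ld * (1 + norm \<alpha>) * B / \<Lambda> ^ k * \<tau>" by (simp add: mult_ac)
      have "norm (quad_deriv c p (x j)) \<le> \<Lambda> + Ld * \<tau>"
        using norm_triangle_sub[of "quad_deriv c p (x j)" l] dz by (simp add: \<Lambda>_def)
      then have lin: "norm (quad_deriv c p (x j) * d j) \<le> (\<Lambda> + Ld * \<tau>) * norm (d j)"
        unfolding norm_mult by (intro mult_right_mono) auto
      have "y j = x j + \<eta>" by (simp add: d_def \<eta>_def)
      then have "d (Suc j) = \<rho> + quad_deriv c p (x j) * \<eta> + quad_param_deriv c p (x j) * \<epsilon> - \<alpha> * \<epsilon>"
        by (simp add: d_def \<rho>_def xSuc ySuc)
      also have "\<alpha> * \<epsilon> = (l * \<alpha> + quad_param_deriv c p a) * \<epsilon>" unfolding \<alpha> ..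
      finally have "d (Suc j) = \<rho> + (quad_deriv c p (x j) * d j + ?m * \<epsilon>)"
        by (simp add: \<eta>_def algebra_simps)
      then have "norm (d (Suc j)) \<le> norm \<rho> + (norm (quad_deriv c p (x j) * d j) + norm (?m * \<epsilon>))"
        by (metis norm_triangle_mono norm_triangle_ineq order_refl)
      also have "\<dots> \<le> (2 * Q * (1 + norm \<alpha>)\<^sup>2 * B * B / \<Lambda> ^ k * \<tau> + 2 * Q * \<tau> * norm (d j))
          + ((\<Lambda> + Ld * \<tau>) * norm (d j) + Ld * (1 + norm \<alpha>) * B / \<Lambda> ^ k * \<tau>)"
        by (intro add_mono \<rho> lin mid)
      also have "\<dots> = (\<Lambda> + A * \<tau>) * norm (d j) + b / \<Lambda> ^ k * \<tau>"
        by (simp add: A_def b_def algebra_simps add_divide_distrib)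
      finally show "norm (d (Suc j)) \<le> (\<Lambda> + A * (\<Lambda> ^ j / \<Lambda> ^ k)) * norm (d j) + b / \<Lambda> ^ k * (\<Lambda> ^ j / \<Lambda> ^ k)"
        by (simp add: \<tau>_def)
    next
      show "exp (A / (\<Lambda> - 1)) * (\<Lambda> ^ k * norm (d 0) + real k * (b / \<Lambda> ^ k)) \<le> 1 / 2"
        using Tk k(2) unfolding E_def by linarith
    qed (use b L in auto)
    then have "norm (d k) \<le> T k" using Tk L by simp
    moreover have "(quad (C k w) ^^ (p * k)) (V k w) - \<phi> w = d k + \<alpha> * \<epsilon>"
      using l0 by (simp add: d_def y_def x_def \<epsilon>_def)
    ultimately show ?thesis using \<alpha>\<epsilon> norm_triangle_ineq[of "d k" "\<alpha> * \<epsilon>"] by simp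
  qed
  show ?thesis
  proof (rule uniform_limitI)
    fix e :: real assume e: "e > 0"
    have *: "(\<lambda>k. T k + norm \<alpha> * B / \<Lambda> ^ k) \<longlonglongrightarrow> 0"
      using tendsto_add_zero[OF T0 inv0[of "norm \<alpha> * B"]] .
    have "\<forall>\<^sub>F k in sequentially. k \<ge> k1 \<and> T k < 1 / 2 \<and> norm \<alpha> * B / \<Lambda> ^ k < 1 / 2 \<and> B / \<Lambda> ^ k < 1
        \<and> R / \<Lambda> ^ k < \<delta> \<and> T k + norm \<alpha> * B / \<Lambda> ^ k < e"
      using e taylor(2)
      by (intro eventually_conj eventually_ge_at_top order_tendstoD(2)[OF T0] order_tendstoD(2)[OF *]
          order_tendstoD(2)[OF inv0]) auto
    then show "\<forall>\<^sub>F k in sequentially. \<forall>w\<in>cball 0 R. dist ((quad (C k w) ^^ (p * k)) (V k w)) (\<phi> w) < e"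
    proof eventually_elim
      case (elim k)
      show ?case
      proof
        fix w assume "w \<in> cball (0::complex) R"
        then have "norm ((quad (C k w) ^^ (p * k)) (V k w) - \<phi> w) \<le> T k + norm \<alpha> * B / \<Lambda> ^ k"
          using elim by (intro key) auto
        then show "dist ((quad (C k w) ^^ (p * k)) (V k w)) (\<phi> w) < e"
          using elim by (simp add: dist_norm)
      qed
    qed
  qed
qed

section \<open>Hausdorff convergence of sets of bounded orbits\<close>

text \<open>
  The Schwarz lemma, applied after moving the right half plane to the disk.
\<close>

lemma harnack:
  assumes F: "F holomorphic_on ball z r" and "r > 0"
    and pos: "\<And>w. w \<in> ball z r \<Longrightarrow> Re (F w) > 0" and w: "dist z w \<le> r / 2"
  shows "Re (F w) \<le> 3 * Re (F z)"
proof -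
  have z_in: "z \<in> ball z r" and w_in: "w \<in> ball z r" using w \<open>r > 0\<close> by auto
  have mem: "z + of_real r * u \<in> ball z r" if "norm u < 1" for u
    using that \<open>r > 0\<close> by (simp add: dist_norm norm_mult)
  define T where "T u = (F (z + of_real r * u) - F z) / (F (z + of_real r * u) + cnj (F z))" for u
  have less: "norm (x - y) < norm (x + cnj y)" if "Re x > 0" "Re y > 0" for x y :: complex
  proof -
    have "(norm (x + cnj y))\<^sup>2 - (norm (x - y))\<^sup>2 = 4 * Re x * Re y"
      unfolding cmod_power2 by (simp add: power2_eq_square algebra_simps)
    then have "(norm (x - y))\<^sup>2 < (norm (x + cnj y))\<^sup>2"
      using that by (smt (verit) mult_pos_pos)
    then show ?thesis by (rule power2_less_imp_less) simp
  qed
  have lessF: "norm (F (z + of_real r * u) - F z) < norm (F (z + of_real r * u) + cnj (F z))"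
    if "norm u < 1" for u
    using mem[OF that] z_in pos by (intro less) auto
  have nz: "F (z + of_real r * u) + cnj (F z) \<noteq> 0" if "norm u < 1" for u
    using lessF[OF that] by (metis norm_ge_zero norm_zero not_less)
  define \<xi> where "\<xi> = (w - z) / of_real r"
  have \<xi>: "norm \<xi> \<le> 1 / 2"
    using w \<open>r > 0\<close> by (simp add: \<xi>_def norm_divide dist_norm norm_minus_commute field_simps)
  have "norm (T \<xi>) \<le> norm \<xi>"
  proof (rule Schwarz_Lemma(1))
    have "(F \<circ> (\<lambda>u. z + of_real r * u)) holomorphic_on ball 0 1"
    proof (rule holomorphic_on_compose_gen[OF _ F])
      show "(\<lambda>u. z + of_real r * u) ` ball 0 1 \<subseteq> ball z r"
        by (intro image_subsetI mem) simp
    qed (intro holomorphic_intros)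
    then have "(\<lambda>u. F (z + of_real r * u)) holomorphic_on ball 0 1" by (simp add: comp_def)
    then show "T holomorphic_on ball 0 1"
      unfolding T_def[abs_def] using nz by (intro holomorphic_intros) auto
    show "norm (T u) < 1" if "norm u < 1" for u
      using lessF[OF that] nz[OF that] by (simp add: T_def norm_divide)
  qed (use \<xi> in \<open>auto simp: T_def\<close>)
  moreover have zw: "z + of_real r * \<xi> = w" using \<open>r > 0\<close> by (simp add: \<xi>_def)
  ultimately have "norm (F w - F z) / norm (F w + cnj (F z)) \<le> norm \<xi>"
    by (simp add: T_def norm_divide)
  then have "norm (F w - F z) / norm (F w + cnj (F z)) \<le> 1 / 2"
    using \<xi> by (rule order_trans)
  moreover have "norm (F w + cnj (F z)) > 0"
    using nz[of \<xi>] \<xi> zw by simp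
  ultimately have "2 * norm (F w - F z) \<le> norm (F w + cnj (F z))" by (simp add: field_simps)
  then have "(2 * norm (F w - F z))\<^sup>2 \<le> (norm (F w + cnj (F z)))\<^sup>2"
    by (intro power_mono) auto
  then have "4 * ((Re (F w) - Re (F z))\<^sup>2 + (Im (F w) - Im (F z))\<^sup>2)
      \<le> (Re (F w) + Re (F z))\<^sup>2 + (Im (F w) - Im (F z))\<^sup>2"
    by (simp add: power_mult_distrib cmod_power2)
  then have "4 * (Re (F w) - Re (F z))\<^sup>2 \<le> (Re (F w) + Re (F z))\<^sup>2"
    using zero_le_power2[of "Im (F w) - Im (F z)"] unfolding distrib_left by linarith
  then have "(2 * (Re (F w) - Re (F z)))\<^sup>2 \<le> (Re (F w) + Re (F z))\<^sup>2"
    unfolding power_mult_distrib by simp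
  then have "2 * (Re (F w) - Re (F z)) \<le> Re (F w) + Re (F z)"
    by (rule power2_le_imp_le) (use pos[OF z_in] pos[OF w_in] in simp)
  then show ?thesis by simp
qed

lemma truncate_disk_eq:
  assumes "r > 0"
  shows "truncate_disk r K = (K \<inter> cball 0 r) \<union> sphere 0 r"
  using assms by (auto simp: truncate_disk_def)

lemma compact_truncate_disk:
  assumes "r > 0" "closed K"
  shows "compact (truncate_disk r K)" "truncate_disk r K \<noteq> {}"
proof -
  show "compact (truncate_disk r K)"
    unfolding truncate_disk_eq[OF assms(1)] using assms(2) by (intro compact_Un closed_Int_compact) auto
  have "of_real r \<in> sphere (0::complex) r" using assms(1) by simp
  then show "truncate_disk r K \<noteq> {}" unfolding truncate_disk_eq[OF assms(1)] by blast
qed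

text \<open>
  The boundary circle absorbs all points that are gained or lost at the rim of the disk, so the two
  semicontinuity conditions inside the disk suffice, by compactness.
\<close>

lemma hausdorff_converges_truncate_disk:
  assumes "r > 0" and closed: "\<And>k. closed (K k)" "closed M"
    and upper: "\<And>s w z. strict_mono s \<Longrightarrow> (\<And>k. w k \<in> K (s k)) \<Longrightarrow> w \<longlonglongrightarrow> z \<Longrightarrow> z \<in> M"
    and lower: "\<And>z \<delta>. z \<in> M \<Longrightarrow> \<delta> > 0 \<Longrightarrow> \<forall>\<^sub>F k in sequentially. K k \<inter> ball z \<delta> \<noteq> {}"
  shows "hausdorff_converges (\<lambda>k. truncate_disk r (K k)) (truncate_disk r M)"
proof -
  let ?T = "truncate_disk r M"
  note compactT = compact_truncate_disk(1)[OF \<open>r > 0\<close> closed(2)]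
  have part1: "\<forall>\<^sub>F k in sequentially. ?T \<subseteq> nbhd \<epsilon> (truncate_disk r (K k))" if \<epsilon>: "\<epsilon> > 0" for \<epsilon>
  proof -
    obtain A where A: "finite A" "A \<subseteq> ?T" "?T \<subseteq> (\<Union>x\<in>A. ball x (\<epsilon> / 2))"
      using seq_compact_imp_totally_bounded[OF compact_imp_seq_compact[OF compactT],
        rule_format, OF half_gt_zero[OF \<epsilon>]]
    by (elim exE conjE)
    have "\<forall>\<^sub>F k in sequentially. truncate_disk r (K k) \<inter> ball z (\<epsilon> / 2) \<noteq> {}" if "z \<in> A" for z
    proof (cases "norm z = r")
      case True
      then have "z \<in> truncate_disk r (K k) \<inter> ball z (\<epsilon> / 2)" for k
        using \<epsilon> \<open>r > 0\<close> by (simp add: truncate_disk_eq)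
      then show ?thesis by (intro always_eventually allI) blast
    next
      case False
      then have z: "z \<in> M" "norm z < r" using A(2) that \<open>r > 0\<close> by (auto simp: truncate_disk_eq)
      have "\<forall>\<^sub>F k in sequentially. K k \<inter> ball z (min (\<epsilon> / 2) (r - norm z)) \<noteq> {}"
        using z \<epsilon> by (intro lower) auto
      then show ?thesis
      proof eventually_elim
        case (elim k)
        then obtain v where v: "v \<in> K k" "dist z v < \<epsilon> / 2" "dist z v < r - norm z" by auto
        have "norm v < r" using v(3) norm_triangle_sub[of v z] by (simp add: dist_norm norm_minus_commute)
        then have "v \<in> truncate_disk r (K k)" using v(1) by (simp add: truncate_disk_def)
        then show ?case using v(2) by auto
      qed
    qed
    then have "\<forall>\<^sub>F k in sequentially. \<forall>z\<in>A. truncate_disk r (K k) \<inter> ball z (\<epsilon> / 2) \<noteq> {}"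
      using A(1) by (simp add: eventually_ball_finite)
    then show ?thesis
    proof eventually_elim
      case (elim k)
      show ?case
      proof
        fix x assume "x \<in> ?T"
        then obtain z where z: "z \<in> A" "dist z x < \<epsilon> / 2" using A(3) by auto
        then obtain v where v: "v \<in> truncate_disk r (K k)" "dist z v < \<epsilon> / 2" using elim by fastforce
        have "dist v x < \<epsilon>" using z v dist_triangle_half_r by blast
        then show "x \<in> nbhd \<epsilon> (truncate_disk r (K k))" using v unfolding nbhd_def by auto
      qed
    qed
  qed
  have part2: "\<forall>\<^sub>F k in sequentially. truncate_disk r (K k) \<subseteq> nbhd \<epsilon> ?T" if \<epsilon>: "\<epsilon> > 0" for \<epsilon>
  proof (rule ccontr)
    assume "\<not> ?thesis"
    then have "infinite {k. \<not> truncate_disk r (K k) \<subseteq> nbhd \<epsilon> ?T}"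
      unfolding eventually_sequentially infinite_nat_iff_unbounded_le by blast
    then obtain s :: "nat \<Rightarrow> nat" where s: "strict_mono s" "\<And>k. \<not> truncate_disk r (K (s k)) \<subseteq> nbhd \<epsilon> ?T"
      using infinite_enumerate by blast
    then have "\<forall>k. \<exists>x. x \<in> truncate_disk r (K (s k)) \<and> x \<notin> nbhd \<epsilon> ?T" by blast
    then obtain w where w: "\<And>k. w k \<in> truncate_disk r (K (s k))" "\<And>k. w k \<notin> nbhd \<epsilon> ?T" by metis
    have "w k \<notin> ?T" for k using w(2)[of k] \<epsilon> by (auto simp: nbhd_def)
    then have wk: "w k \<in> K (s k)" "norm (w k) \<le> r" for k
      using w(1)[of k] \<open>r > 0\<close> by (auto simp: truncate_disk_eq)
    have "bounded (range w)" using wk(2) unfolding bounded_iff by blast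
    then obtain z t where t: "strict_mono t" "(w \<circ> t) \<longlonglongrightarrow> z"
      using bounded_imp_convergent_subsequence by blast
    have "z \<in> M"
    proof (rule upper)
      show "strict_mono (s \<circ> t)" using s(1) t(1) by (rule strict_mono_o)
      show "(w \<circ> t) k \<in> K ((s \<circ> t) k)" for k using wk(1) by simp
    qed (rule t)
    moreover have "norm z \<le> r"
      by (rule Lim_norm_ubound[OF _ t(2)]) (auto simp: wk(2))
    ultimately have "z \<in> ?T" using \<open>r > 0\<close> by (simp add: truncate_disk_eq)
    obtain k where "dist ((w \<circ> t) k) z < \<epsilon>"
      using tendstoD[OF t(2) \<epsilon>] unfolding eventually_sequentially by blast
    then have "w (t k) \<in> nbhd \<epsilon> ?T" using \<open>z \<in> ?T\<close> unfolding nbhd_def by (auto simp: dist_commute)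
    then show False using w(2) by blast
  qed
  show ?thesis
    unfolding hausdorff_converges_def
  proof (intro conjI allI impI)
    show "\<exists>k0. \<forall>k\<ge>k0. ?T \<subseteq> nbhd \<epsilon> (truncate_disk r (K k)) \<and> truncate_disk r (K k) \<subseteq> nbhd \<epsilon> ?T"
      if "\<epsilon> > 0" for \<epsilon>
      using eventually_conj[OF part1[OF that] part2[OF that]] unfolding eventually_sequentially .
  qed (rule compact_truncate_disk[OF \<open>r > 0\<close>] closed)+
qed

lemma uniform_limit_diagonal:
  fixes \<Phi> :: "nat \<Rightarrow> 'a::metric_space \<Rightarrow> 'b::metric_space"
  assumes u: "uniform_limit S \<Phi> \<phi> sequentially" and "isCont \<phi> z" and w: "w \<longlonglongrightarrow> z" "\<And>k. w k \<in> S"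
    and s: "filterlim s sequentially sequentially"
  shows "(\<lambda>k. \<Phi> (s k) (w k)) \<longlonglongrightarrow> \<phi> z"
proof (rule tendstoI)
  fix e :: real assume e: "e > 0"
  have "(\<lambda>k. \<phi> (w k)) \<longlonglongrightarrow> \<phi> z" using \<open>isCont \<phi> z\<close> w(1) by (rule isCont_tendsto_compose)
  then have "\<forall>\<^sub>F k in sequentially. dist (\<phi> (w k)) (\<phi> z) < e / 2" using e by (intro tendstoD) auto
  moreover have "\<forall>\<^sub>F k in sequentially. \<forall>x\<in>S. dist (\<Phi> k x) (\<phi> x) < e / 2"
    using u half_gt_zero[OF e] unfolding uniform_limit_iff by blast
  then have "\<forall>\<^sub>F k in sequentially. \<forall>x\<in>S. dist (\<Phi> (s k) x) (\<phi> x) < e / 2"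
    using s unfolding filterlim_iff by blast
  ultimately show "\<forall>\<^sub>F k in sequentially. dist (\<Phi> (s k) (w k)) (\<phi> z) < e"
  proof eventually_elim
    case (elim k)
    then have "dist (\<Phi> (s k) (w k)) (\<phi> (w k)) < e / 2" using w(2) by blast
    then show ?case using elim(1) dist_triangle_half_r[of "\<phi> (w k)"] by (simp add: dist_commute)
  qed
qed

text \<open>
  In this and the next estimate, a factor \<open>2\<close> on the modulus absorbs the parameter, so that one step
  amounts to squaring and \<open>ln (norm ((quad c ^^ j) z)) / 2 ^ j\<close> is controlled for all \<open>j\<close> by the starting point.
\<close>

lemma quad_iter_growth_lower:
  assumes "norm c \<le> b" "norm z \<ge> 2 * (b + 1)"
  shows "(norm z / 2) ^ (2 ^ j) \<le> norm ((quad c ^^ j) z) / 2"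
proof (induction j)
  case (Suc j)
  have b: "b \<ge> 0" using assms(1) norm_ge_zero[of c] by linarith
  define x where "x = norm ((quad c ^^ j) z)"
  have "norm z / 2 \<le> (norm z / 2) ^ (2 ^ j)"
    using assms(2) b by (intro self_le_power) auto
  then have "norm z / 2 \<le> x / 2" using Suc unfolding x_def by (rule order_trans)
  then have x: "x / 2 \<ge> b + 1" using assms(2) by simp
  have "(norm z / 2) ^ (2 ^ Suc j) = ((norm z / 2) ^ (2 ^ j))\<^sup>2"
    by (simp only: power_mult[symmetric] power_Suc2)
  also have "\<dots> \<le> (x / 2)\<^sup>2"
    using Suc unfolding x_def by (intro power_mono) auto
  also have "\<dots> \<le> (x\<^sup>2 - b) / 2"
  proof -
    have "(x / 2) * (x / 2) \<ge> (b + 1) * (b + 1)" using x b by (intro mult_mono) auto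
    then have "x\<^sup>2 \<ge> 4 * ((b + 1) * (b + 1))" by (simp add: power2_eq_square)
    moreover have "(b + 1) * (b + 1) \<ge> b" using b by (simp add: algebra_simps)
    ultimately have "x\<^sup>2 \<ge> 2 * b" using b by linarith
    then show ?thesis by (simp add: power2_eq_square)
  qed
  also have "\<dots> \<le> norm (((quad c ^^ j) z)\<^sup>2 + c) / 2"
    using norm_triangle_ineq2[of "((quad c ^^ j) z)\<^sup>2" "- c"] assms(1)
    by (simp add: norm_power x_def)
  finally show ?case by (simp only: quad_iter_Suc)
qed simp

lemma quad_iter_growth_upper:
  assumes "norm c \<le> \<rho>" "norm z \<le> \<rho>" "\<rho> \<ge> 1"
  shows "2 * norm ((quad c ^^ j) z) \<le> (2 * \<rho>) ^ (2 ^ j)"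
proof (induction j)
  case (Suc j)
  define x where "x = norm ((quad c ^^ j) z)"
  define y where "y = (2 * \<rho>) ^ (2 ^ j)"
  have y: "y \<ge> 2 * \<rho>" unfolding y_def using assms(3) by (intro self_le_power) auto
  have "(2 * x)\<^sup>2 \<le> y\<^sup>2" using Suc unfolding x_def y_def by (intro power_mono) auto
  moreover have "y * y \<ge> (2 * \<rho>) * 2" using y assms(3) by (intro mult_mono) auto
  ultimately have "2 * (x\<^sup>2 + \<rho>) \<le> y\<^sup>2" by (simp add: power2_eq_square)
  moreover have "norm (((quad c ^^ j) z)\<^sup>2 + c) \<le> x\<^sup>2 + \<rho>"
    using norm_triangle_ineq[of "((quad c ^^ j) z)\<^sup>2" c] assms(1) by (simp add: norm_power x_def)
  moreover have "y\<^sup>2 = (2 * \<rho>) ^ (2 ^ Suc j)"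
    by (simp only: y_def power_mult[symmetric] power_Suc2)
  ultimately show ?case unfolding quad_iter_Suc
    by (metis mult_le_cancel_left_pos order_trans zero_less_numeral)
qed (use assms in simp)

text \<open>
  Limits of bounded orbits are bounded, which gives one half. For the other half, suppose that the
  orbits of all \<open>\<Phi> k w\<close> with \<open>w\<close> in a disk around \<open>w0\<close> are unbounded, although \<open>\<phi> w0\<close> has a bounded
  orbit. The escape rates of these orbits are positive harmonic functions of \<open>w\<close>. They are close to \<open>0\<close>
  at \<open>w0\<close>, but bounded below at a nearby point \<open>w1\<close> with \<open>\<phi> w1\<close> outside the filled Julia set (which
  exists as that set has no interior and \<open>\<phi>\<close> is open), contrary to Harnack's inequality. To avoid limits,
  \<open>ln (norm f) / 2 ^ n\<close> for a late iterate \<open>f\<close> takes the place of the escape rate.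
\<close>

lemma escape_sets_converge:
  fixes \<phi> :: "complex \<Rightarrow> complex" and \<Phi> C :: "nat \<Rightarrow> complex \<Rightarrow> complex"
  assumes \<phi>: "\<phi> holomorphic_on UNIV" "\<not> \<phi> constant_on UNIV"
    and int: "interior (filled_julia c) = {}"
    and hol: "\<And>k. \<Phi> k holomorphic_on UNIV" "\<And>k. C k holomorphic_on UNIV"
    and lim: "\<And>R. R \<ge> 0 \<Longrightarrow> uniform_limit (cball 0 R) \<Phi> \<phi> sequentially"
      "\<And>R. R \<ge> 0 \<Longrightarrow> uniform_limit (cball 0 R) C (\<lambda>_. c) sequentially"
    and "r > 0"
  shows "hausdorff_converges (\<lambda>k. truncate_disk r {w. \<Phi> k w \<in> filled_julia (C k w)})
    (truncate_disk r (\<phi> -` filled_julia c))"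
proof (rule hausdorff_converges_truncate_disk)
  have cont: "continuous_on UNIV (\<Phi> k)" "continuous_on UNIV (C k)" "continuous_on UNIV \<phi>" for k
    using hol \<phi> by (auto intro: holomorphic_on_imp_continuous_on)
  show "closed {w. \<Phi> k w \<in> filled_julia (C k w)}" for k
  proof -
    have "closed (\<Inter>n. {w. norm ((quad (C k w) ^^ n) (\<Phi> k w)) \<le> norm (C k w) + 2})"
      by (intro closed_INT ballI closed_Collect_le continuous_intros cont)
    moreover have "{w. \<Phi> k w \<in> filled_julia (C k w)}
        = (\<Inter>n. {w. norm ((quad (C k w) ^^ n) (\<Phi> k w)) \<le> norm (C k w) + 2})"
      by (auto simp: filled_julia_iff)
    ultimately show ?thesis by simp
  qed
  show "closed (\<phi> -` filled_julia c)"
    using cont(3) closed_filled_julia by (simp add: continuous_on_closed_vimage[of UNIV, simplified])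
  have pointwise: "(\<lambda>k. \<Phi> (s k) (w k)) \<longlonglongrightarrow> \<phi> z" "(\<lambda>k. C (s k) (w k)) \<longlonglongrightarrow> c"
    if w: "w \<longlonglongrightarrow> z" and s: "filterlim s sequentially sequentially" for s w z
  proof -
    have "Bseq w" using w by (rule convergent_imp_Bseq[OF convergentI])
    then obtain R where R: "R > 0" "\<And>k. norm (w k) \<le> R" by (auto simp: Bseq_def)
    show "(\<lambda>k. \<Phi> (s k) (w k)) \<longlonglongrightarrow> \<phi> z"
      by (rule uniform_limit_diagonal[OF lim(1)[of R] entire_isCont[OF \<phi>(1)] w _ s]) (use R in auto)
    show "(\<lambda>k. C (s k) (w k)) \<longlonglongrightarrow> c"
      by (rule uniform_limit_diagonal[OF lim(2)[of R] _ w _ s]) (use R in auto)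
  qed
  show "z \<in> \<phi> -` filled_julia c"
    if s: "strict_mono s" and w: "\<And>k. w k \<in> {w. \<Phi> (s k) w \<in> filled_julia (C (s k) w)}" "w \<longlonglongrightarrow> z" for s w z
  proof -
    note pw = pointwise[OF w(2) filterlim_subseq[OF s]]
    have "norm ((quad c ^^ n) (\<phi> z)) \<le> norm c + 2" for n
    proof (rule LIMSEQ_le)
      show "(\<lambda>k. norm ((quad (C (s k) (w k)) ^^ n) (\<Phi> (s k) (w k)))) \<longlonglongrightarrow> norm ((quad c ^^ n) (\<phi> z))"
        by (intro tendsto_intros pw)
      show "(\<lambda>k. norm (C (s k) (w k)) + 2) \<longlonglongrightarrow> norm c + 2"
        by (intro tendsto_intros pw)
      show "\<exists>N. \<forall>k\<ge>N. norm ((quad (C (s k) (w k)) ^^ n) (\<Phi> (s k) (w k))) \<le> norm (C (s k) (w k)) + 2"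
        using w(1) by (auto simp: filled_julia_iff)
    qed
    then show ?thesis by (simp add: filled_julia_iff)
  qed
  show "\<forall>\<^sub>F k in sequentially. {w. \<Phi> k w \<in> filled_julia (C k w)} \<inter> ball w0 \<delta> \<noteq> {}"
    if "w0 \<in> \<phi> -` filled_julia c" and \<delta>: "\<delta> > 0" for w0 \<delta>
  proof (rule ccontr)
    assume "\<not> ?thesis"
    then have freq: "\<exists>\<^sub>F k in sequentially. \<forall>w\<in>ball w0 \<delta>. \<Phi> k w \<notin> filled_julia (C k w)"
      unfolding not_eventually by (rule frequently_elim1) auto
    have w0: "\<phi> w0 \<in> filled_julia c" using that by simp
    have "open (\<phi> ` ball w0 (\<delta> / 4))"
      by (rule open_mapping_thm[OF \<phi>(1) open_UNIV connected_UNIV _ _ \<phi>(2)]) auto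
    moreover have "\<phi> w0 \<in> \<phi> ` ball w0 (\<delta> / 4)" using \<delta> by auto
    ultimately obtain w1 where w1: "w1 \<in> ball w0 (\<delta> / 4)" "\<phi> w1 \<notin> filled_julia c"
      using int interior_maximal[of "\<phi> ` ball w0 (\<delta> / 4)" "filled_julia c"] by blast
    define b where "b = norm c + 1"
    have b: "b \<ge> 1" by (simp add: b_def)
    obtain m1 where m1: "norm ((quad c ^^ m1) (\<phi> w1)) > 2 * (b + 1)"
    proof -
      obtain N where "\<forall>n\<ge>N. norm ((quad c ^^ n) (\<phi> w1)) \<ge> 2 * (b + 1) + 1"
        using escapes_if_not_filled_julia[OF w1(2)] by blast
      then show ?thesis using that[of N] by force
    qed
    \<comment> \<open>A lower bound for the escape rate at \<open>w1\<close> that holds for all large \<open>k\<close>, and below a number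
      of steps after which the one at \<open>w0\<close> is known to be at most a quarter of it.\<close>
    define \<eta> where "\<eta> = ln (b + 1) / 2 ^ m1"
    have \<eta>: "\<eta> > 0" using b by (simp add: \<eta>_def)
    define \<rho> where "\<rho> = b + 2"
    obtain m0 where m0: "ln (2 * \<rho>) / 2 ^ m0 < \<eta> / 4"
    proof -
      obtain m where "(2::real) ^ m > ln (2 * \<rho>) / (\<eta> / 4)" using real_arch_pow[of 2] by auto
      then have "ln (2 * \<rho>) / 2 ^ m < \<eta> / 4" using \<eta> by (simp add: field_simps)
      then show ?thesis by (rule that)
    qed
    have pt: "(\<lambda>k. \<Phi> k w) \<longlonglongrightarrow> \<phi> w" "(\<lambda>k. C k w) \<longlonglongrightarrow> c" for w
      using pointwise[OF tendsto_const filterlim_ident] by auto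
    have C_small: "\<forall>\<^sub>F k in sequentially. norm (C k w) < b" for w
      by (rule order_tendstoD(2)[OF tendsto_norm[OF pt(2)]]) (simp add: b_def)
    have "\<forall>\<^sub>F k in sequentially. norm ((quad (C k w1) ^^ m1) (\<Phi> k w1)) > 2 * (b + 1)"
      by (rule order_tendstoD(1)[OF _ m1]) (intro tendsto_intros pt)
    moreover have "\<forall>\<^sub>F k in sequentially. norm ((quad (C k w0) ^^ m0) (\<Phi> k w0)) < \<rho>"
    proof (rule order_tendstoD(2))
      show "(\<lambda>k. norm ((quad (C k w0) ^^ m0) (\<Phi> k w0))) \<longlonglongrightarrow> norm ((quad c ^^ m0) (\<phi> w0))"
        by (intro tendsto_intros pt)
      have "norm ((quad c ^^ m0) (\<phi> w0)) \<le> norm c + 2" using w0 unfolding filled_julia_iff by blast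
      then show "norm ((quad c ^^ m0) (\<phi> w0)) < \<rho>" by (simp add: \<rho>_def b_def)
    qed
    ultimately have "\<forall>\<^sub>F k in sequentially. norm (C k w0) < b \<and> norm (C k w1) < b \<and>
        norm ((quad (C k w1) ^^ m1) (\<Phi> k w1)) > 2 * (b + 1) \<and> norm ((quad (C k w0) ^^ m0) (\<Phi> k w0)) < \<rho>"
      using C_small[of w0] C_small[of w1] by eventually_elim auto
    then obtain k where k: "\<forall>w\<in>ball w0 \<delta>. \<Phi> k w \<notin> filled_julia (C k w)"
      "norm (C k w0) < b" "norm (C k w1) < b"
      "norm ((quad (C k w1) ^^ m1) (\<Phi> k w1)) > 2 * (b + 1)" "norm ((quad (C k w0) ^^ m0) (\<Phi> k w0)) < \<rho>"
      using frequently_ex[OF frequently_eventually_frequently[OF freq]] by blast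
    define h where "h n w = (quad (C k w) ^^ n) (\<Phi> k w)" for n w
    have h_add: "h (i + n) w = (quad (C k w) ^^ i) (h n w)" for i n w
      by (simp add: h_def quad_iter_add)
    obtain N where N: "\<And>w. w \<in> cball w0 (\<delta> / 2) \<Longrightarrow> norm (h N w) > norm (C k w) + 2"
    proof -
      define U where "U n = {w. norm (h n w) > norm (C k w) + 2}" for n
      have "open (U n)" for n
        unfolding U_def h_def by (intro open_Collect_less continuous_intros cont)
      moreover have "cball w0 (\<delta> / 2) \<subseteq> (\<Union>n. U n)"
      proof
        fix w assume "w \<in> cball w0 (\<delta> / 2)"
        then have "w \<in> ball w0 \<delta>" using \<delta> by auto
        then have "\<Phi> k w \<notin> filled_julia (C k w)" using k(1) by blast
        then show "w \<in> (\<Union>n. U n)" by (auto simp: filled_julia_iff U_def h_def not_le)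
      qed
      ultimately obtain I where I: "finite I" "cball w0 (\<delta> / 2) \<subseteq> (\<Union>n\<in>I. U n)"
        using compactE_image[OF compact_cball, of UNIV U w0 "\<delta> / 2"] by auto
      have "norm (h (Max I) w) > norm (C k w) + 2" if w: "w \<in> cball w0 (\<delta> / 2)" for w
      proof -
        obtain n where "n \<in> I" "w \<in> U n" using I(2) w by blast
        then have n: "n \<in> I" "norm (h n w) > norm (C k w) + 2" by (simp_all add: U_def)
        have "norm (h n w) \<le> norm ((quad (C k w) ^^ (Max I - n)) (h n w))"
          using n by (intro quad_iter_norm_ge) simp
        also have "\<dots> = norm (h (Max I) w)"
          using n(1) I(1) by (simp add: h_add[symmetric])
        finally show ?thesis using n by simp
      qed
      then show ?thesis by (rule that)
    qed
    define n where "n = N + m0 + m1"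
    have big: "norm (h n w) > 2" if "w \<in> ball w0 (\<delta> / 2)" for w
    proof -
      have "norm (h N w) > norm (C k w) + 2" using that by (intro N) auto
      then have "norm (h N w) \<le> norm (h ((m0 + m1) + N) w)"
        unfolding h_add by (intro quad_iter_norm_ge) simp
      moreover have "(m0 + m1) + N = n" by (simp add: n_def)
      ultimately have "norm (h N w) \<le> norm (h n w)" by simp
      then show ?thesis
        using \<open>norm (h N w) > norm (C k w) + 2\<close> norm_ge_zero[of "C k w"] by linarith
    qed
    have hol_h: "h n holomorphic_on UNIV"
      unfolding h_def[abs_def] by (intro holomorphic_intros hol)
    have "h n holomorphic_on ball w0 (\<delta> / 2)" "contractible (ball w0 (\<delta> / 2))"
      using hol_h by (auto intro: holomorphic_on_subset convex_imp_contractible)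
    moreover have "h n w \<noteq> 0" if "w \<in> ball w0 (\<delta> / 2)" for w using big[OF that] by auto
    ultimately obtain G where G: "G holomorphic_on ball w0 (\<delta> / 2)"
      "\<And>w. w \<in> ball w0 (\<delta> / 2) \<Longrightarrow> h n w = exp (G w)"
      using contractible_imp_holomorphic_log[of "h n" "ball w0 (\<delta> / 2)"] by blast
    have ReG: "Re (G w) = ln (norm (h n w))" if "w \<in> ball w0 (\<delta> / 2)" for w
      using G(2)[OF that] by (simp add: norm_exp_eq_Re)
    have w_in: "w0 \<in> ball w0 (\<delta> / 2)" "w1 \<in> ball w0 (\<delta> / 2)" using \<delta> w1 by auto
    have "Re (G w1) \<le> 3 * Re (G w0)"
    proof (rule harnack[OF G(1)])
      show "Re (G w) > 0" if "w \<in> ball w0 (\<delta> / 2)" for w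
        unfolding ReG[OF that] using big[OF that] by (intro ln_gt_zero) linarith
    qed (use \<delta> w1 in auto)
    then have compare: "ln (norm (h n w1)) \<le> 3 * ln (norm (h n w0))" using ReG w_in by simp
    have "2 ^ n * \<eta> \<le> ln (norm (h n w1))"
    proof -
      let ?x = "h m1 w1" and ?j = "N + m0"
      have x: "norm ?x \<ge> 2 * (b + 1)" using k(4) by (simp add: h_def)
      have "2 ^ n * \<eta> = 2 ^ ?j * ln (b + 1)" by (simp add: \<eta>_def n_def power_add)
      also have "\<dots> = ln ((b + 1) ^ (2 ^ ?j))" using b by (simp add: ln_realpow)
      also have "\<dots> \<le> ln (norm (h n w1))"
      proof (rule ln_mono)
        have "(b + 1) ^ (2 ^ ?j) \<le> (norm ?x / 2) ^ (2 ^ ?j)"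
          using x b by (intro power_mono) auto
        also have "\<dots> \<le> norm ((quad (C k w1) ^^ ?j) ?x) / 2"
          using x k(3) by (intro quad_iter_growth_lower[of _ b]) auto
        also have "\<dots> \<le> norm (h n w1)" by (simp add: h_add[symmetric] n_def)
        finally show "(b + 1) ^ (2 ^ ?j) \<le> norm (h n w1)" .
      qed (use b big w_in in auto)
      finally show ?thesis .
    qed
    moreover have "ln (norm (h n w0)) \<le> 2 ^ n * (\<eta> / 4)"
    proof -
      let ?x = "h m0 w0" and ?j = "N + m1"
      have "norm (h n w0) \<le> 2 * norm ((quad (C k w0) ^^ ?j) ?x)"
        by (simp add: h_add[symmetric] n_def add_ac)
      also have "\<dots> \<le> (2 * \<rho>) ^ (2 ^ ?j)"
        using k(2,5) b by (intro quad_iter_growth_upper) (auto simp: \<rho>_def h_def)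
      finally have "ln (norm (h n w0)) \<le> ln ((2 * \<rho>) ^ (2 ^ ?j))"
        using big[OF w_in(1)] b by (intro ln_mono) (auto simp: \<rho>_def)
      also have "\<dots> = 2 ^ ?j * ln (2 * \<rho>)" using b by (simp add: ln_realpow \<rho>_def)
      also have "\<dots> = 2 ^ n * (ln (2 * \<rho>) / 2 ^ m0)" by (simp add: n_def power_add)
      also have "\<dots> \<le> 2 ^ n * (\<eta> / 4)" using m0 by (intro mult_left_mono) auto
      finally show ?thesis .
    qed
    ultimately have "2 ^ n * \<eta> \<le> 3 * (2 ^ n * (\<eta> / 4))" using compare by linarith
    then have "4 * \<eta> \<le> 3 * \<eta>" by simp
    then show False using \<eta> by linarith
  qed
qed (rule \<open>r > 0\<close>)

section \<open>Similarity of the Mandelbrot set and the Julia set\<close>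

lemma rescale_eq:
  assumes "a \<noteq> 0"
  shows "rescale a b K = {w. b + w / a \<in> K}"
proof
  show "rescale a b K \<subseteq> {w. b + w / a \<in> K}" using assms by (auto simp: rescale_def)
  show "{w. b + w / a \<in> K} \<subseteq> rescale a b K"
  proof
    fix w assume "w \<in> {w. b + w / a \<in> K}"
    moreover have "w = a * ((b + w / a) - b)" using assms by simp
    ultimately show "w \<in> rescale a b K" unfolding rescale_def by blast
  qed
qed

theorem theorem2:
  fixes c\<^sub>0 :: complex
  assumes "misiurewicz c\<^sub>0"
  shows "\<exists>(\<phi> :: complex \<Rightarrow> complex) (\<rho> :: nat \<Rightarrow> complex) (q :: complex).
           \<phi> holomorphic_on UNIV \<and> \<not> \<phi> constant_on UNIV \<and>
           (\<forall>k. \<rho> k \<noteq> 0) \<and> \<rho> \<longlonglongrightarrow> 0 \<and> q \<noteq> 0 \<and>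
           (let \<J> = \<phi> -` julia c\<^sub>0 in
             \<forall>\<^sub>F r :: real in at_top.
               hausdorff_converges
                 (\<lambda>k. truncate_disk r (rescale (inverse (\<rho> k)) c\<^sub>0 (julia c\<^sub>0)))
                 (truncate_disk r \<J>) \<and>
               hausdorff_converges
                 (\<lambda>k. truncate_disk r (rescale (inverse (\<rho> k) * q) c\<^sub>0 mandelbrot))
                 (truncate_disk r \<J>))"
proof -
  define c where "c = c\<^sub>0"
  obtain m p where m: "m \<ge> 1" and p: "p \<ge> 1"
    and per': "(quad c ^^ p) ((quad c ^^ m) c) = (quad c ^^ m) c"
    and rep': "norm (deriv (quad c ^^ p) ((quad c ^^ m) c)) > 1"
    using assms unfolding misiurewicz_def c_def Let_def by blast
  define L where "L = Suc m"
  define a where "a = (quad c ^^ L) 0"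
  have orbit: "(quad c ^^ n) c = (quad c ^^ Suc n) 0" for n
    unfolding funpow_Suc_right comp_apply by (simp add: quad_def[of c 0])
  have a_eq: "a = (quad c ^^ m) c" by (simp only: a_def L_def orbit)
  define l where "l = quad_deriv c p a"
  have per: "(quad c ^^ p) a = a" using per' by (simp add: a_eq)
  have l: "norm l > 1"
    using rep' DERIV_imp_deriv[OF has_field_derivative_quad_iter[where c = c and n = p and z = a]]
    by (simp add: a_eq l_def)
  have l_nz: "l \<noteq> 0" "l \<noteq> 1" using l by auto
  have perL: "(quad c ^^ p) ((quad c ^^ L) 0) = (quad c ^^ L) 0"
    and nzL: "quad_deriv c p ((quad c ^^ L) 0) \<noteq> 0"
    using per l_nz unfolding a_def l_def by auto
  have empty: "interior (filled_julia c) = {}"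
    using filled_julia_interior_empty[where c = c and p = p and L = L] per p l
    unfolding a_def l_def by blast
  have julia: "julia c = filled_julia c"
    using empty closed_filled_julia by (simp add: julia_def frontier_def)
  have F: "(quad c ^^ p) holomorphic_on UNIV"
    using holomorphic_on_quad_iter[of "\<lambda>_. c" UNIV "\<lambda>z. z" p] by simp
  obtain \<phi> K \<delta> where \<phi>: "\<phi> holomorphic_on UNIV" "\<And>w. \<phi> (l * w) = (quad c ^^ p) (\<phi> w)"
    and taylor: "K \<ge> 0" "\<delta> > 0" "\<And>w. norm w \<le> \<delta> \<Longrightarrow> norm (\<phi> w - a - w) \<le> K * (norm w)\<^sup>2"
    using poincare_function[OF F per has_field_derivative_quad_iter] l unfolding l_def by metis
  have nonconst: "\<not> \<phi> constant_on UNIV"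
  proof
    assume "\<phi> constant_on UNIV"
    then obtain v where "\<And>w. \<phi> w = v" unfolding constant_on_def by blast
    moreover have "\<phi> 0 = a" using taylor(3)[of 0] taylor(2) by simp
    ultimately have const: "\<phi> w = a" for w by metis
    define t where "t = min \<delta> (1 / (2 * (K + 1)))"
    have t: "t > 0" "t \<le> \<delta>" "t \<le> 1 / (2 * (K + 1))" using taylor(1,2) by (simp_all add: t_def)
    have "t \<le> K * t\<^sup>2" using taylor(3)[of "of_real t"] t const by simp
    then have "1 \<le> K * t" using t(1) by (simp add: power2_eq_square)
    also have "\<dots> \<le> K * (1 / (2 * (K + 1)))" using t(3) taylor(1) by (rule mult_left_mono)
    also have "\<dots> < 1" using taylor(1) by (simp add: field_simps)
    finally show False by simp
  qed
  \<comment> \<open>The periodic point moves with the parameter at speed \<open>\<alpha>\<close>. The point reached after \<open>m\<close> steps moves at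
    speed \<open>A\<close> with the starting point, and below at speed \<open>B\<close> relative to the periodic point when the
    parameter varies and the starting point is the critical value.\<close>
  define \<alpha> where "\<alpha> = quad_param_deriv c p a / (1 - l)"
  have \<alpha>: "l * \<alpha> + quad_param_deriv c p a = \<alpha>"
    using l_nz by (simp add: \<alpha>_def field_simps)
  define A where "A = quad_deriv c m c"
  have "(quad c ^^ Suc i) 0 \<noteq> 0" for i
    by (rule critical_orbit_nonzero[OF perL p nzL]) simp
  then have A: "A \<noteq> 0"
    unfolding A_def quad_deriv_eq_0_iff orbit by blast
  define B where "B = quad_param_deriv c L 0 - \<alpha>"
  have B: "B \<noteq> 0"
  proof
    assume "B = 0"
    then have "quad_param_deriv c L 0 = \<alpha>" by (simp add: B_def)
    then have "quad_param_deriv c (p + L) 0 = quad_param_deriv c L 0"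
      using \<alpha> by (simp add: quad_param_deriv_add a_def[symmetric] l_def[symmetric])
    then show False using transversality[OF perL p nzL] by (simp add: add.commute)
  qed
  define \<rho> where "\<rho> k = 1 / (A * l ^ k)" for k
  define q where "q = B / A"
  have \<rho>: "\<rho> k \<noteq> 0" for k using A l_nz by (simp add: \<rho>_def)
  have q: "q \<noteq> 0" using A B by (simp add: q_def)
  have norm_rho: "norm (\<rho> k) = (1 / norm A) * (1 / norm l ^ k)" for k
    by (simp add: \<rho>_def norm_divide norm_mult norm_power)
  have inv0: "(\<lambda>k. s / norm l ^ k) \<longlonglongrightarrow> 0" for s
    using tendsto_mult[OF tendsto_const[of s] LIMSEQ_inverse_realpow_zero[OF l]]
    by (simp add: divide_inverse)
  have rho0: "\<rho> \<longlonglongrightarrow> 0"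
  proof (rule tendsto_norm_zero_cancel)
    show "(\<lambda>k. norm (\<rho> k)) \<longlonglongrightarrow> 0" using inv0[of "1 / norm A"] by (simp add: norm_rho)
  qed
  have pow_pos: "norm l ^ k > 0" for k using l by (intro zero_less_power) linarith
  define \<Phi>1 where "\<Phi>1 k w = (quad c ^^ (p * k)) ((quad c ^^ m) (c + w * \<rho> k))" for k w
  define C where "C k w = c + w * (\<rho> k / q)" for k w
  define \<Phi>2 where "\<Phi>2 k w = (quad (C k w) ^^ (p * k)) ((quad (C k w) ^^ L) 0)" for k w
  have C_close: "norm (C k w - c) \<le> (R / norm B) / norm l ^ k" if "norm w \<le> R" for k w R
  proof -
    have "C k w - c = w / (B * l ^ k)" using A by (simp add: C_def \<rho>_def q_def)
    then have "norm (C k w - c) = norm w / norm B / norm l ^ k" by (simp add: norm_divide norm_mult norm_power)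
    also have "\<dots> \<le> R / norm B / norm l ^ k" using that by (intro divide_right_mono) auto
    finally show ?thesis .
  qed
  have lim_C: "uniform_limit (cball 0 R) C (\<lambda>_. c) sequentially" for R
  proof (rule uniform_limitI)
    fix e :: real assume "e > 0"
    then have "\<forall>\<^sub>F k in sequentially. (R / norm B) / norm l ^ k < e"
      by (rule order_tendstoD(2)[OF inv0])
    then show "\<forall>\<^sub>F k in sequentially. \<forall>w\<in>cball 0 R. dist (C k w) c < e"
    proof eventually_elim
      case (elim k)
      show ?case
      proof
        fix w assume "w \<in> cball (0::complex) R"
        then have "norm (C k w - c) \<le> (R / norm B) / norm l ^ k" by (intro C_close) simp
        then show "dist (C k w) c < e" using elim by (simp add: dist_norm)
      qed
    qed
  qed
  have lim1: "uniform_limit (cball 0 R) \<Phi>1 \<phi> sequentially" if R: "R \<ge> 0" for R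
  proof -
    obtain Q where Q: "Q \<ge> 0" "\<And>x \<epsilon> \<delta>. norm x \<le> norm c \<Longrightarrow> norm \<epsilon> \<le> 1 \<Longrightarrow> norm \<delta> \<le> 1 \<Longrightarrow>
      norm ((quad (c + \<epsilon>) ^^ m) (x + \<delta>) - (quad c ^^ m) x
        - quad_deriv c m x * \<delta> - quad_param_deriv c m x * \<epsilon>) \<le> Q * (norm \<epsilon> + norm \<delta>)\<^sup>2"
      using quad_iter_expansion[where R = "norm c" and c = c and n = m] by blast
    define D where "D = Q * (R / norm A)\<^sup>2"
    obtain k1 where k1: "\<And>k. k \<ge> k1 \<Longrightarrow> (R / norm A) / norm l ^ k < 1"
      using order_tendstoD(2)[OF inv0[of "R / norm A"], of 1] by (auto simp: eventually_sequentially)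
    show ?thesis
      unfolding \<Phi>1_def
    proof (rule shadowing[OF l_def l \<alpha> \<phi> taylor])
      show "D \<ge> 0" using Q by (simp add: D_def)
      then show "norm (c - c) \<le> D / norm l ^ k" for k by simp
      show "norm ((quad c ^^ m) (c + w * \<rho> k) - a - \<alpha> * (c - c) - w / l ^ k) \<le> D / (norm l ^ k * norm l ^ k)"
        if k: "k \<ge> k1" and w: "norm w \<le> R" for k w
      proof -
        have le: "norm (w * \<rho> k) \<le> (R / norm A) / norm l ^ k"
          using w by (simp add: norm_mult norm_rho divide_right_mono)
        then have "norm (w * \<rho> k) \<le> 1" using k1[OF k] by simp
        then have "norm ((quad c ^^ m) (c + w * \<rho> k) - a - A * (w * \<rho> k)) \<le> Q * (norm (w * \<rho> k))\<^sup>2"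
          using Q(2)[of c 0 "w * \<rho> k"] by (simp add: a_eq A_def)
        also have "\<dots> \<le> Q * ((R / norm A) / norm l ^ k)\<^sup>2"
          using le Q(1) by (intro mult_left_mono power_mono) auto
        also have "\<dots> = D / (norm l ^ k * norm l ^ k)"
          by (simp add: D_def power2_eq_square)
        also have "A * (w * \<rho> k) = w / l ^ k" using A by (simp add: \<rho>_def)
        finally show ?thesis by simp
      qed
    qed (use R in auto)
  qed
  have lim2: "uniform_limit (cball 0 R) \<Phi>2 \<phi> sequentially" if R: "R \<ge> 0" for R
  proof -
    obtain Q where Q: "Q \<ge> 0" "\<And>x \<epsilon> \<delta>. norm x \<le> 0 \<Longrightarrow> norm \<epsilon> \<le> 1 \<Longrightarrow> norm \<delta> \<le> 1 \<Longrightarrow>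
      norm ((quad (c + \<epsilon>) ^^ L) (x + \<delta>) - (quad c ^^ L) x
        - quad_deriv c L x * \<delta> - quad_param_deriv c L x * \<epsilon>) \<le> Q * (norm \<epsilon> + norm \<delta>)\<^sup>2"
      using quad_iter_expansion[where R = 0 and c = c and n = L] by blast
    define b where "b = R / norm B"
    have b: "b \<ge> 0" using R by (simp add: b_def)
    define D where "D = b + Q * b\<^sup>2"
    obtain k1 where k1: "\<And>k. k \<ge> k1 \<Longrightarrow> b / norm l ^ k < 1"
      using order_tendstoD(2)[OF inv0[of b], of 1] by (auto simp: eventually_sequentially)
    show ?thesis
      unfolding \<Phi>2_def
    proof (rule shadowing[OF l_def l \<alpha> \<phi> taylor])
      show "D \<ge> 0" using Q b by (simp add: D_def)
      show "norm (C k w - c) \<le> D / norm l ^ k" if "norm w \<le> R" for k w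
      proof -
        have "norm (C k w - c) \<le> b / norm l ^ k" using C_close[OF that] by (simp add: b_def)
        also have "\<dots> \<le> D / norm l ^ k"
          using Q pow_pos[of k] by (intro divide_right_mono) (auto simp: D_def)
        finally show ?thesis .
      qed
      show "norm ((quad (C k w) ^^ L) 0 - a - \<alpha> * (C k w - c) - w / l ^ k) \<le> D / (norm l ^ k * norm l ^ k)"
        if k: "k \<ge> k1" and w: "norm w \<le> R" for k w
      proof -
        define \<epsilon> where "\<epsilon> = C k w - c"
        have le: "norm \<epsilon> \<le> b / norm l ^ k" using C_close[OF w] by (simp add: b_def \<epsilon>_def)
        then have "norm \<epsilon> \<le> 1" using k1[OF k] by simp
        then have "norm ((quad (C k w) ^^ L) 0 - a - quad_param_deriv c L 0 * \<epsilon>) \<le> Q * (norm \<epsilon>)\<^sup>2"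
          using Q(2)[of 0 \<epsilon> 0] by (simp add: a_def \<epsilon>_def)
        also have "\<dots> \<le> Q * (b / norm l ^ k)\<^sup>2"
          using le Q(1) by (intro mult_left_mono power_mono) auto
        also have "\<dots> = Q * b\<^sup>2 / (norm l ^ k * norm l ^ k)"
          by (simp add: power2_eq_square)
        also have "\<dots> \<le> D / (norm l ^ k * norm l ^ k)"
          using b pow_pos[of k] by (intro divide_right_mono) (auto simp: D_def)
        also have "quad_param_deriv c L 0 * \<epsilon> = \<alpha> * \<epsilon> + w / l ^ k"
        proof -
          have "B * \<epsilon> = w / l ^ k" using A B by (simp add: \<epsilon>_def C_def \<rho>_def q_def)
          then have "quad_param_deriv c L 0 * \<epsilon> - \<alpha> * \<epsilon> = w / l ^ k"
            unfolding B_def left_diff_distrib .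
          then show ?thesis unfolding diff_eq_eq by (simp only: add.commute)
        qed
        finally show ?thesis unfolding \<epsilon>_def by (simp only: diff_diff_add add.assoc)
      qed
    qed (use R in auto)
  qed
  have set1: "rescale (inverse (\<rho> k)) c (julia c) = {w. \<Phi>1 k w \<in> filled_julia c}" for k
  proof -
    have "rescale (inverse (\<rho> k)) c (julia c) = {w. c + w * \<rho> k \<in> filled_julia c}"
      using \<rho> by (subst rescale_eq) (simp_all add: julia divide_inverse)
    then show ?thesis by (simp add: \<Phi>1_def quad_iter_in_filled_julia_iff)
  qed
  have set2: "rescale (inverse (\<rho> k) * q) c mandelbrot = {w. \<Phi>2 k w \<in> filled_julia (C k w)}" for k
  proof -
    have "rescale (inverse (\<rho> k) * q) c mandelbrot = {w. C k w \<in> mandelbrot}"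
      using \<rho> q by (subst rescale_eq) (simp_all add: C_def divide_inverse mult_ac)
    also have "\<dots> = {w. \<Phi>2 k w \<in> filled_julia (C k w)}"
    proof (intro Collect_cong)
      fix w
      have "C k w \<in> filled_julia (C k w) \<longleftrightarrow> 0 \<in> filled_julia (C k w)"
        using quad_iter_in_filled_julia_iff[of 1 "C k w" 0] by (simp add: quad_def)
      then show "C k w \<in> mandelbrot \<longleftrightarrow> \<Phi>2 k w \<in> filled_julia (C k w)"
        unfolding mandelbrot_iff \<Phi>2_def quad_iter_in_filled_julia_iff .
    qed
    finally show ?thesis .
  qed
  have hol_C: "C k holomorphic_on UNIV" for k
    unfolding C_def[abs_def] by (intro holomorphic_intros)
  have hol1: "\<Phi>1 k holomorphic_on UNIV" for k
    unfolding \<Phi>1_def[abs_def] by (intro holomorphic_intros)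
  have hol2: "\<Phi>2 k holomorphic_on UNIV" for k
    unfolding \<Phi>2_def[abs_def] by (intro holomorphic_intros hol_C)
  have conv1: "hausdorff_converges (\<lambda>k. truncate_disk r (rescale (inverse (\<rho> k)) c (julia c)))
      (truncate_disk r (\<phi> -` julia c))" if "r > 0" for r
    unfolding set1 unfolding julia
    by (rule escape_sets_converge[OF \<phi>(1) nonconst empty hol1 _ lim1 _ that]) (auto simp: uniform_limit_iff)
  have conv2: "hausdorff_converges (\<lambda>k. truncate_disk r (rescale (inverse (\<rho> k) * q) c mandelbrot))
      (truncate_disk r (\<phi> -` julia c))" if "r > 0" for r
    unfolding set2 julia
    by (rule escape_sets_converge[OF \<phi>(1) nonconst empty hol2 hol_C lim2 lim_C that])
  have both: "\<forall>\<^sub>F r in at_top.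
      hausdorff_converges (\<lambda>k. truncate_disk r (rescale (inverse (\<rho> k)) c (julia c))) (truncate_disk r (\<phi> -` julia c)) \<and>
      hausdorff_converges (\<lambda>k. truncate_disk r (rescale (inverse (\<rho> k) * q) c mandelbrot)) (truncate_disk r (\<phi> -` julia c))"
    by (rule eventually_mono[OF eventually_gt_at_top[of 0]]) (rule conjI[OF conv1 conv2])
  have "\<forall>k. \<rho> k \<noteq> 0" using \<rho> by (rule allI)
  note result = conjI[OF \<phi>(1) conjI[OF nonconst conjI[OF this conjI[OF rho0 conjI[OF q both]]]]]
  show ?thesis
    unfolding Let_def
    by (rule exI[of _ \<phi>], rule exI[of _ \<rho>], rule exI[of _ q], rule result[unfolded c_def])
qed

end
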